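(* For all integers $n\geq 0$ and $m\geq 0$, \[ B_{2,15}\left(3^{2m+1}n+\frac{7\cdot 3^{2m+1}-5}{8}\right)\equiv 2^m B_{2,15}(3n+2)\pmod{5}, \] \[ B_{2,15}\left(3^{2m+2}n+\frac{23\cdot 3^{2m+1}-5}{8}\right)\equiv 0\pmod{5}, \] \[ B_{2,15}\left(3^{2(m+1)+1}n+\frac{13\cdot 3^{2(m+1)}-5}{8}\right)\equiv 0\pmod{5}. \]
   Context: For integers $s,t>1$, an $(s,t)$-regular bipartition of $n$ is a pair $(\lambda,\mu)$ of partitions with total sum of parts $n$ such that no part of $\lambda$ is divisible by $s$ and no part of $\mu$ is divisible by $t$. $B_{s,t}(n)$ denotes the number of $(s,t)$-regular bipartitions of $n$; equivalently $\sum_{n\geq0}B_{s,t}(n)q^n=\frac{f_sf_t}{f_1^2}$, where $f_k=\prod_{m\geq1}(1-q^{mk})$. *)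

theory Defs
  imports "HOL-Library.Multiset" "HOL-Number_Theory.Cong"
begin

text \<open>A partition is represented by the finite multiset of its (positive) parts.\<close>

definition partition_of :: "nat multiset \<Rightarrow> bool" where
  "partition_of \<alpha> \<longleftrightarrow> (\<forall>p \<in># \<alpha>. p > 0)"

definition regular_bipartitions :: "nat \<Rightarrow> nat \<Rightarrow> nat \<Rightarrow> (nat multiset \<times> nat multiset) set" where
  "regular_bipartitions s t n =
     {(\<alpha>, \<beta>). partition_of \<alpha> \<and> partition_of \<beta> \<and>
             (\<forall>p \<in># \<alpha>. \<not> s dvd p) \<and> (\<forall>p \<in># \<beta>. \<not> t dvd p) \<and>
             sum_mset \<alpha> + sum_mset \<beta> = n}"

definition B :: "nat \<Rightarrow> nat \<Rightarrow> nat \<Rightarrow> nat" where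
  "B s t n = card (regular_bipartitions s t n)"

lemma size_le_sum_mset: "partition_of \<alpha> \<Longrightarrow> size \<alpha> \<le> sum_mset \<alpha>"
  unfolding partition_of_def by (induction \<alpha>) auto

lemma finite_partitions_le: "finite {\<alpha>. partition_of \<alpha> \<and> sum_mset \<alpha> \<le> n}"
proof (rule finite_subset)
  show "{\<alpha>. partition_of \<alpha> \<and> sum_mset \<alpha> \<le> n} \<subseteq> mset ` {xs. set xs \<subseteq> {..n} \<and> length xs \<le> n}"
  proof
    fix \<alpha> :: "nat multiset"
    assume "\<alpha> \<in> {\<alpha>. partition_of \<alpha> \<and> sum_mset \<alpha> \<le> n}"
    then have part: "partition_of \<alpha>" and sum: "sum_mset \<alpha> \<le> n" by auto
    obtain xs where xs: "mset xs = \<alpha>" using ex_mset by blast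
    have "length xs \<le> n"
      using size_le_sum_mset[OF part] sum xs by (metis le_trans size_mset)
    moreover have "set xs \<subseteq> {..n}"
    proof
      fix x assume "x \<in> set xs"
      then have "x \<le> sum_list xs" by (simp add: member_le_sum_list)
      then show "x \<in> {..n}" using sum xs by (auto simp flip: sum_mset_sum_list)
    qed
    ultimately show "\<alpha> \<in> mset ` {xs. set xs \<subseteq> {..n} \<and> length xs \<le> n}" using xs by blast
  qed
  show "finite (mset ` {xs :: nat list. set xs \<subseteq> {..n} \<and> length xs \<le> n})"
    by (intro finite_imageI finite_lists_length_le) simp
qed

lemma finite_regular_bipartitions: "finite (regular_bipartitions s t n)"
proof (rule finite_subset)
  let ?P = "{\<alpha>. partition_of \<alpha> \<and> sum_mset \<alpha> \<le> n}"
  show "regular_bipartitions s t n \<subseteq> ?P \<times> ?P"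
    unfolding regular_bipartitions_def by auto
  show "finite (?P \<times> ?P)" using finite_partitions_le by blast
qed

end

theory Submission
  imports Defs "HOL-Computational_Algebra.Formal_Power_Series" "HOL-Computational_Algebra.Polynomial"
begin

text \<open>
  Write \<open>f\<^sub>k\<close> for \<open>\<Prod>\<^sub>m (1 - q\<^bsup>km\<^esup>)\<close> and \<open>\<phi> = \<Sum> (-1)\<^bsup>j\<^esup> q\<^bsup>j*j\<^esup> = f\<^sub>1\<^sup>2 / f\<^sub>2\<close>, so that the generating
  function of \<open>B\<^bsub>2,15\<^esub>\<close> is \<open>f\<^bsub>15\<^esub> / \<phi>\<close>. Splitting the exponents \<open>j*j\<close> by \<open>j\<close> modulo 3 gives
  \<open>\<phi>(q) = a(q\<^sup>3) - 2 q b(q\<^sup>3)\<close>, and rationalising \<open>1 / \<phi>\<close> by the norm over the cube roots of unity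
  isolates the terms with exponents \<open>3n + 2\<close>. Using \<open>f\<^sub>5 = f\<^sub>1\<^sup>5\<close> modulo 5, one obtains
  \<open>\<Sum> B(3n+2) q\<^bsup>n\<^esup> = 4 \<psi>(q) f\<^sub>6\<^sup>3\<close> modulo 5, where \<open>\<psi>\<close> sums \<open>q\<^bsup>j(j+1)/2\<^esup>\<close> over \<open>j \<ge> 0\<close>. By Jacobi's identity for \<open>f\<^sub>1\<^sup>3\<close> the coefficients
  on the right are signed sums over the representations \<open>x\<^sup>2 + 6 y\<^sup>2 = 8n + 7\<close> with \<open>x, y\<close> odd.
  Congruences modulo 3 and 9 make these sums vanish or force both \<open>x\<close> and \<open>y\<close> to be divisible by 3;
  dividing by 3 multiplies the sum by \<open>-3\<close>, which is 2 modulo 5.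
\<close>

unbundle fps_syntax

section \<open>Truncated congruence, Euler products and sections of power series\<close>

text \<open>Congruence modulo \<open>q^(n+1)\<close>. Identities of infinite products are proved at
  each truncation order, where finite products may stand in for infinite ones.\<close>

definition fps_eq_upto :: "nat \<Rightarrow> 'a::zero fps \<Rightarrow> 'a fps \<Rightarrow> bool" where
  "fps_eq_upto n F G \<longleftrightarrow> (\<forall>i\<le>n. F $ i = G $ i)"

lemma fps_eq_uptoD: "fps_eq_upto n F G \<Longrightarrow> i \<le> n \<Longrightarrow> F $ i = G $ i"
  by (simp add: fps_eq_upto_def)

lemma fps_eq_upto_refl [simp]: "fps_eq_upto n F F"
  by (simp add: fps_eq_upto_def)

lemma fps_eq_upto_sym: "fps_eq_upto n F G \<Longrightarrow> fps_eq_upto n G F"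
  by (simp add: fps_eq_upto_def)

lemma fps_eq_upto_trans [trans]: "fps_eq_upto n F G \<Longrightarrow> fps_eq_upto n G H \<Longrightarrow> fps_eq_upto n F H"
  by (simp add: fps_eq_upto_def)

lemma fps_eq_upto_add:
  "fps_eq_upto n F F' \<Longrightarrow> fps_eq_upto n G G' \<Longrightarrow> fps_eq_upto n (F + G) (F' + G')"
  by (simp add: fps_eq_upto_def)

lemma fps_eq_upto_diff:
  "fps_eq_upto n F F' \<Longrightarrow> fps_eq_upto n G G' \<Longrightarrow> fps_eq_upto n (F - G) (F' - G')"
  by (simp add: fps_eq_upto_def)

lemma fps_eq_upto_mult:
  fixes F G :: "'a::semiring_0 fps"
  shows "fps_eq_upto n F F' \<Longrightarrow> fps_eq_upto n G G' \<Longrightarrow> fps_eq_upto n (F * G) (F' * G')"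
  by (auto simp: fps_eq_upto_def fps_mult_nth intro!: sum.cong)

lemma fps_eq_upto_power:
  fixes F :: "'a::semiring_1 fps"
  shows "fps_eq_upto n F F' \<Longrightarrow> fps_eq_upto n (F ^ k) (F' ^ k)"
  by (induction k) (simp_all add: fps_eq_upto_mult)

lemma fps_eqI_upto: "(\<And>n. fps_eq_upto n F G) \<Longrightarrow> F = G"
  by (auto simp: fps_eq_iff fps_eq_upto_def)

text \<open>Coefficient \<open>i\<close> of \<open>U * F\<close> is \<open>F $ i\<close> plus terms
  in earlier coefficients of \<open>F\<close>, so the coefficients of \<open>F\<close> are recovered
  one after another.\<close>

lemma fps_eq_upto_mult_left_cancel:
  fixes F G U :: "'a::comm_ring_1 fps"
  assumes "fps_eq_upto n (U * F) (U * G)" "U $ 0 = 1"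
  shows "fps_eq_upto n F G"
  unfolding fps_eq_upto_def
proof (intro allI impI)
  fix i show "i \<le> n \<Longrightarrow> F $ i = G $ i"
  proof (induction i rule: less_induct)
    case (less i)
    have split: "(U * H) $ i = H $ i + (\<Sum>k=Suc 0..i. U $ k * H $ (i - k))" for H
      using assms(2) by (simp add: fps_mult_nth sum.atLeast_Suc_atMost)
    have "(\<Sum>k=Suc 0..i. U $ k * F $ (i - k)) = (\<Sum>k=Suc 0..i. U $ k * G $ (i - k))"
      using less by (intro sum.cong) auto
    then show ?case using fps_eq_uptoD[OF assms(1) less.prems] by (simp add: split)
  qed
qed

lemma fps_eq_upto_mult_one_minus_X_power:
  fixes F :: "'a::comm_ring_1 fps"
  assumes "n < k"
  shows "fps_eq_upto n (F * (1 - fps_X ^ k)) F"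
  using assms by (auto simp: fps_eq_upto_def right_diff_distrib fps_X_power_mult_right_nth)

section \<open>Euler products and their truncations\<close>

definition euler_prod :: "nat \<Rightarrow> nat \<Rightarrow> int fps" where
  "euler_prod d n = (\<Prod>k<n. 1 - fps_X ^ (d * Suc k))"

text \<open>For \<open>d > 0\<close> all factors from the \<open>n\<close>-th on have exponent above
  \<open>n\<close>, so coefficient \<open>n\<close> of the infinite product can be read off the
  first \<open>n\<close> factors.\<close>

definition euler :: "nat \<Rightarrow> int fps" where
  "euler d = Abs_fps (\<lambda>n. euler_prod d n $ n)"

lemma euler_prod_0 [simp]: "euler_prod d 0 = 1"
  by (simp add: euler_prod_def)

lemma euler_prod_Suc: "euler_prod d (Suc n) = euler_prod d n * (1 - fps_X ^ (d * Suc n))"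
  by (simp add: euler_prod_def)

lemma euler_prod_stable:
  assumes "d > 0" "n \<le> M" "M \<le> N"
  shows "fps_eq_upto n (euler_prod d N) (euler_prod d M)"
  using assms(3)
proof (induction N rule: dec_induct)
  case base
  then show ?case by simp
next
  case (step N)
  have "n < Suc N" using assms step by simp
  also have "Suc N \<le> d * Suc N" using assms(1) by (cases d) auto
  finally show ?case
    using fps_eq_upto_mult_one_minus_X_power fps_eq_upto_trans step.IH
    by (metis euler_prod_Suc)
qed

lemma euler_upto:
  assumes "d > 0" "n \<le> N"
  shows "fps_eq_upto n (euler d) (euler_prod d N)"
  unfolding fps_eq_upto_def
proof (intro allI impI)
  fix i assume "i \<le> n"
  then show "euler d $ i = euler_prod d N $ i"
    using fps_eq_uptoD[OF euler_prod_stable[of d i i N]] assms by (simp add: euler_def)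
qed

lemma euler_nth_0 [simp]: "euler d $ 0 = 1"
  by (simp add: euler_def)

lemma euler_nonzero [simp]: "euler d \<noteq> 0"
  by (metis euler_nth_0 fps_zero_nth zero_neq_one)

section \<open>Substituting a power of q, and sections along residue classes\<close>

lemma fps_compose_X_power_nth:
  fixes F :: "'a::comm_ring_1 fps"
  assumes "d > 0"
  shows "(F oo fps_X ^ d) $ n = (if d dvd n then F $ (n div d) else 0)"
proof -
  have "(F oo fps_X ^ d) $ n = (\<Sum>i=0..n. if i * d = n then F $ i else 0)"
    unfolding fps_compose_nth by (intro sum.cong) (auto simp: mult.commute simp flip: power_mult)
  also have "\<dots> = (\<Sum>i\<in>{i\<in>{0..n}. i * d = n}. F $ i)"
    by (simp add: sum.If_cases Int_def)
  also have "{i\<in>{0..n}. i * d = n} = (if d dvd n then {n div d} else {})"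
    using assms by (auto elim!: dvdE)
  finally show ?thesis by simp
qed

lemma fps_compose_eq_upto:
  fixes F :: "'a::comm_ring_1 fps"
  assumes "d > 0" "fps_eq_upto n F G"
  shows "fps_eq_upto n (F oo fps_X ^ d) (G oo fps_X ^ d)"
  using assms by (auto simp: fps_eq_upto_def fps_compose_X_power_nth elim!: dvdE)
    (metis One_nat_def Suc_leI le_trans mult.commute mult.right_neutral mult_le_mono2)

lemma fps_X_power_compose_X_power:
  "d > 0 \<Longrightarrow> (fps_X ^ k :: int fps) oo fps_X ^ d = fps_X ^ (d * k)"
  by (simp add: fps_compose_power[symmetric] power_mult zero_power)

lemma euler_prod_compose: "d > 0 \<Longrightarrow> euler_prod k n oo fps_X ^ d = euler_prod (d * k) n"
  unfolding euler_prod_def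
  by (subst fps_compose_prod_distrib)
    (simp_all add: fps_compose_sub_distrib fps_X_power_compose_X_power zero_power mult.assoc del: mult_Suc_right)

lemma euler_compose:
  assumes "d > 0" "k > 0"
  shows "euler k oo fps_X ^ d = euler (d * k)"
proof (rule fps_eqI_upto)
  fix n
  have "fps_eq_upto n (euler k oo fps_X ^ d) (euler_prod k n oo fps_X ^ d)"
    using assms by (intro fps_compose_eq_upto euler_upto) auto
  also have "fps_eq_upto n \<dots> (euler (d * k))"
    using assms by (auto simp: euler_prod_compose intro!: fps_eq_upto_sym[OF euler_upto])
  finally show "fps_eq_upto n (euler k oo fps_X ^ d) (euler (d * k))" .
qed

definition fps_section :: "nat \<Rightarrow> nat \<Rightarrow> 'a::zero fps \<Rightarrow> 'a fps" where
  "fps_section d r F = Abs_fps (\<lambda>n. F $ (d * n + r))"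

lemma fps_section_add: "fps_section d r (F + G :: 'a::comm_ring_1 fps) = fps_section d r F + fps_section d r G"
  by (simp add: fps_section_def fps_eq_iff)

text \<open>A series in \<open>q^d\<close> does not mix residue classes modulo \<open>d\<close>:
  only indices \<open>i = d * k\<close> contribute, and \<open>r < d\<close> forces
  \<open>k \<le> n\<close>.\<close>

lemma fps_section_mult_compose:
  fixes F C :: "'a::comm_ring_1 fps"
  assumes "r < d"
  shows "fps_section d r (F * (C oo fps_X ^ d)) = fps_section d r F * C"
proof (rule fps_ext)
  fix n
  have d: "d > 0" using assms by simp
  have "(F * (C oo fps_X ^ d)) $ (d * n + r)
     = (\<Sum>i\<in>{0..d * n + r}. (C oo fps_X ^ d) $ i * F $ (d * n + r - i))"
    by (subst mult.commute) (simp add: fps_mult_nth)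
  also have "\<dots> = (\<Sum>i\<in>(\<lambda>k. d * k) ` {0..n}. (C oo fps_X ^ d) $ i * F $ (d * n + r - i))"
  proof (rule sum.mono_neutral_right)
    show "(\<lambda>k. d * k) ` {0..n} \<subseteq> {0..d * n + r}" by (auto intro!: trans_le_add1)
    have "i \<in> (\<lambda>k. d * k) ` {0..n}" if "i \<le> d * n + r" "d dvd i" for i
    proof -
      obtain k where k: "i = d * k" using \<open>d dvd i\<close> by auto
      have "d * k < d * Suc n" using that k assms by simp
      then have "k \<le> n" using d by (metis less_Suc_eq_le mult_less_cancel1)
      then show ?thesis using k by auto
    qed
    then show "\<forall>i\<in>{0..d * n + r} - (\<lambda>k. d * k) ` {0..n}.
        (C oo fps_X ^ d) $ i * F $ (d * n + r - i) = 0"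
      using d by (auto simp: fps_compose_X_power_nth)
  qed simp
  also have "\<dots> = (\<Sum>k=0..n. C $ k * F $ (d * (n - k) + r))"
    using d by (subst sum.reindex)
      (auto simp: inj_on_def fps_compose_X_power_nth diff_mult_distrib2 intro!: sum.cong)
  also have "\<dots> = (C * fps_section d r F) $ n"
    by (simp add: fps_mult_nth fps_section_def)
  finally show "fps_section d r (F * (C oo fps_X ^ d)) $ n = (fps_section d r F * C) $ n"
    by (simp add: fps_section_def mult.commute)
qed

lemma fps_section_X_power:
  "r < d \<Longrightarrow> i < d \<Longrightarrow> fps_section d r (fps_X ^ i :: 'a::comm_ring_1 fps) = (if i = r then 1 else 0)"
proof -
  assume *: "r < d" "i < d"
  have "d * n + r = i \<longleftrightarrow> i = r \<and> n = 0" for n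
    using * by (cases n) auto
  then show ?thesis by (auto simp: fps_section_def fps_eq_iff)
qed

section \<open>The Jacobi triple product\<close>

text \<open>The Gaussian binomial by its Pascal recurrence. Being free of division, it applies both
  to \<open>q = fps_X ^ d\<close> and to a constant polynomial over power series.\<close>

fun qbinomial :: "'a::comm_ring_1 \<Rightarrow> nat \<Rightarrow> nat \<Rightarrow> 'a" where
  "qbinomial q n 0 = 1"
| "qbinomial q 0 (Suc k) = 0"
| "qbinomial q (Suc n) (Suc k) = qbinomial q n k + q ^ Suc k * qbinomial q n (Suc k)"

lemma qbinomial_eq_0: "n < k \<Longrightarrow> qbinomial q n k = 0"
  by (induction q n k rule: qbinomial.induct) auto

lemma Suc_choose_two: "Suc k choose 2 = k + (k choose 2)"
  by (simp add: numeral_2_eq_2)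

text \<open>Induction on \<open>n\<close> for arbitrary \<open>y\<close>: splitting off the factor
  \<open>k = 0\<close> leaves the shorter product with \<open>y * q\<close> in place of
  \<open>y\<close>.\<close>

lemma qbinomial_theorem:
  fixes x y q :: "'a::comm_ring_1"
  shows "(\<Prod>k<n. x + y * q ^ k)
       = (\<Sum>k\<le>n. qbinomial q n k * q ^ (k choose 2) * y ^ k * x ^ (n - k))"
proof (induction n arbitrary: y)
  case 0
  then show ?case by (simp add: numeral_2_eq_2)
next
  case (Suc n)
  define c where "c k = qbinomial q n k * q ^ (Suc k choose 2) * y ^ k * x ^ (n - k)" for k
  have c: "qbinomial q n k * q ^ (k choose 2) * (y * q) ^ k * x ^ (n - k) = c k" for k
    by (simp add: c_def power_mult_distrib Suc_choose_two power_add mult_ac)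
  have "(\<Prod>k<Suc n. x + y * q ^ k) = (x + y) * (\<Prod>k<n. x + (y * q) * q ^ k)"
    by (subst prod.lessThan_Suc_shift) (simp add: mult_ac)
  also have "\<dots> = (x + y) * (\<Sum>k\<le>n. c k)"
    by (simp add: Suc.IH c)
  also have "\<dots> = x * (\<Sum>k\<le>Suc n. c k) + y * (\<Sum>k\<le>n. c k)"
    by (simp add: distrib_right c_def qbinomial_eq_0)
  also have "\<dots> = x * c 0 + (\<Sum>k\<le>n. x * c (Suc k) + y * c k)"
    by (subst sum.atMost_Suc_shift) (simp add: distrib_left sum_distrib_left sum.distrib)
  also have "x * c 0 = x ^ Suc n"
    by (simp add: c_def numeral_2_eq_2)
  \<comment> \<open>The q-Pascal recurrence in disguise. The case \<open>k = n\<close> is separate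
    because there \<open>c (Suc n)\<close> vanishes, while for \<open>k < n\<close> the exponent of
    \<open>x\<close> drops by one.\<close>
  also have "x * c (Suc k) + y * c k
      = qbinomial q (Suc n) (Suc k) * q ^ (Suc k choose 2) * y ^ Suc k * x ^ (n - k)"
    if "k \<le> n" for k
  proof (cases "k = n")
    case True
    then show ?thesis by (simp add: c_def qbinomial_eq_0)
  next
    case False
    then have "n - k = Suc (n - Suc k)" using that by simp
    then have "x * c (Suc k) = qbinomial q n (Suc k) * q ^ (Suc (Suc k) choose 2) * y ^ Suc k * x ^ (n - k)"
      by (simp only: c_def power_Suc mult_ac)
    also have "q ^ (Suc (Suc k) choose 2) = q ^ Suc k * q ^ (Suc k choose 2)"
      by (simp only: Suc_choose_two[of "Suc k"] power_add)
    finally show ?thesis by (simp add: c_def algebra_simps)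
  qed
  then have "(\<Sum>k\<le>n. x * c (Suc k) + y * c k)
      = (\<Sum>k\<le>n. qbinomial q (Suc n) (Suc k) * q ^ (Suc k choose 2) * y ^ Suc k * x ^ (n - k))"
    by (intro sum.cong) auto
  finally show ?case
    by (subst sum.atMost_Suc_shift) (simp add: numeral_2_eq_2)
qed

text \<open>The quotient formula for Gaussian binomials with denominators cleared. Induction on
  \<open>k + l\<close>; the recurrence reduces it to
  \<open>(1 - q^k) + q^k (1 - q^l) = 1 - q^(k+l)\<close>.\<close>

lemma qbinomial_mult_prod:
  fixes q :: "'a::comm_ring_1"
  shows "qbinomial q (k + l) k * ((\<Prod>i<k. 1 - q ^ Suc i) * (\<Prod>i<l. 1 - q ^ Suc i))
       = (\<Prod>i<k + l. 1 - q ^ Suc i)"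
proof -
  define P where "P n = (\<Prod>i<n. 1 - q ^ Suc i)" for n
  have P_Suc: "P (Suc n) = P n * (1 - q ^ Suc n)" for n
    by (simp add: P_def)
  have "qbinomial q (k + l) k * (P k * P l) = P (k + l)"
  proof (induction "k + l" arbitrary: k l)
    case 0
    then show ?case by (simp add: P_def)
  next
    case (Suc n)
    show ?case
    proof (cases k)
      case 0
      then show ?thesis by (simp add: P_def)
    next
      case k: (Suc k')
      have 1: "qbinomial q n k' * (P k' * P l) = P n"
        using Suc.hyps(1)[of k' l] Suc.hyps(2) k by simp
      have 2: "qbinomial q n k * (P k * P l) = P n * (1 - q ^ l)"
      proof (cases l)
        case 0
        then show ?thesis using Suc.hyps(2) by (simp add: qbinomial_eq_0)
      next
        case l: (Suc l')
        then have "qbinomial q n k * (P k * P l') = P n"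
          using Suc.hyps(1)[of k l'] Suc.hyps(2) by simp
        then show ?thesis by (simp only: l P_Suc mult.assoc[symmetric])
      qed
      have Pk: "P k = P k' * (1 - q ^ k)" by (simp only: k P_Suc)
      have rec: "qbinomial q (k + l) k = qbinomial q n k' + q ^ k * qbinomial q n k"
        using Suc.hyps(2)[symmetric] by (simp add: k)
      have 3: "qbinomial q n k' * (P k * P l) = P n * (1 - q ^ k)"
        unfolding Pk 1[symmetric] by (simp only: mult_ac)
      have "qbinomial q (k + l) k * (P k * P l)
          = qbinomial q n k' * (P k * P l) + q ^ k * (qbinomial q n k * (P k * P l))"
        unfolding rec by (simp only: distrib_right mult.assoc)
      also have "\<dots> = P n * (1 - q ^ (k + l))"
        unfolding 2 3 by (simp add: algebra_simps power_add)
      also have "\<dots> = P (k + l)"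
        using Suc.hyps(2)[symmetric] by (simp only: P_Suc)
      finally show ?thesis .
    qed
  qed
  then show ?thesis by (simp add: P_def)
qed

lemma prod_power_eq_choose_two: "(\<Prod>k<n. q ^ k) = (q::'a::comm_monoid_mult) ^ (n choose 2)"
  by (induction n) (simp_all add: Suc_choose_two power_add numeral_2_eq_2 mult.commute)

text \<open>As \<open>k\<close> and \<open>l\<close> grow, the Gaussian binomial in
  \<open>q^d\<close> tends to \<open>1 / euler d\<close>. A second factor \<open>euler d\<close>
  turns the claim into \<open>qbinomial_mult_prod\<close> and is then cancelled.\<close>

lemma euler_mult_qbinomial:
  assumes "d > 0" "m \<le> k" "m \<le> l"
  shows "fps_eq_upto m (euler d * qbinomial (fps_X ^ d) (k + l) k) 1"
proof (rule fps_eq_upto_mult_left_cancel)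
  have E: "(\<Prod>i<n. 1 - (fps_X ^ d :: int fps) ^ Suc i) = euler_prod d n" for n
    by (simp add: euler_prod_def power_mult[symmetric] del: power_Suc mult_Suc_right)
  have "fps_eq_upto m (euler d * (euler d * qbinomial (fps_X ^ d) (k + l) k))
     (euler_prod d k * (euler_prod d l * qbinomial (fps_X ^ d) (k + l) k))"
    using assms by (intro fps_eq_upto_mult euler_upto fps_eq_upto_refl) auto
  also have "\<dots> = euler_prod d (k + l)"
    using qbinomial_mult_prod[of "fps_X ^ d :: int fps" k l] by (simp only: E mult_ac)
  also have "fps_eq_upto m \<dots> (euler d * 1)"
    using assms by (simp add: fps_eq_upto_sym[OF euler_upto])
  finally show "fps_eq_upto m (euler d * (euler d * qbinomial (fps_X ^ d) (k + l) k)) (euler d * 1)" .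
qed simp

section \<open>Two-sided theta series and the triple product\<close>

text \<open>The two-sided series with terms \<open>w j * q^(e j)\<close>. It has this meaning when
  the fibres of \<open>e\<close> are finite, as a sum over an infinite set is 0 by
  convention.\<close>

definition theta :: "(int \<Rightarrow> int) \<Rightarrow> (int \<Rightarrow> nat) \<Rightarrow> int fps" where
  "theta w e = Abs_fps (\<lambda>m. \<Sum>j | e j = m. w j)"

text \<open>The index \<open>j = k - n\<close> runs from \<open>-n\<close> to \<open>n + 1\<close>.
  A term of degree at most \<open>m\<close> has \<open>\<bar>j\<bar> \<le> m + 1\<close>, so
  \<open>k\<close> and \<open>2 * n + 1 - k\<close> are both at least \<open>m\<close> and its
  Gaussian binomial times \<open>euler d\<close> acts as 1.\<close>

lemma theta_limit:
  assumes "d > 0" and e: "\<And>j. \<bar>j\<bar> \<le> int (e j) + 1" and n: "2 * m + 1 \<le> n"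
  shows "fps_eq_upto m (theta w e)
    (euler d * (\<Sum>k\<le>2 * n + 1. qbinomial (fps_X ^ d) (2 * n + 1) k
        * (fps_const (w (int k - int n)) * fps_X ^ e (int k - int n))))"
  unfolding fps_eq_upto_def
proof (intro allI impI)
  fix i assume i: "i \<le> m"
  let ?b = "\<lambda>k. qbinomial (fps_X ^ d) (2 * n + 1) k :: int fps"
  let ?j = "\<lambda>k. int k - int n"
  have *: "(euler d * ?b k * (fps_const (w (?j k)) * fps_X ^ e (?j k))) $ i
      = (if e (?j k) = i then w (?j k) else 0)" if "k \<le> 2 * n + 1" for k
  proof (cases "e (?j k) \<le> i")
    case True
    then have "\<bar>?j k\<bar> \<le> int m + 1" using e[of "?j k"] i by linarith
    then have "m \<le> k" "m \<le> 2 * n + 1 - k" using n that by linarith+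
    then have "fps_eq_upto m (euler d * ?b k) 1"
      using euler_mult_qbinomial[of d m k "2 * n + 1 - k"] assms that by simp
    from fps_eq_uptoD[OF this] have "(euler d * ?b k) $ (i - e (?j k)) = (1 :: int fps) $ (i - e (?j k))"
      using i by simp
    then show ?thesis using True
      by (simp add: mult.left_commute[of _ "fps_const _"] fps_X_power_mult_right_nth)
  next
    case False
    then show ?thesis
      by (simp add: mult.left_commute[of _ "fps_const _"] fps_X_power_mult_right_nth)
  qed
  have J: "j \<in> ?j ` {..2 * n + 1}" if "e j = i" for j
  proof -
    have "\<bar>j\<bar> \<le> int m + 1" using e[of j] i that by linarith
    then show ?thesis using n by (intro image_eqI[of _ _ "nat (j + int n)"]) auto
  qed
  have "theta w e $ i = (\<Sum>j | e j = i. w j)" by (simp add: theta_def)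
  also have "\<dots> = (\<Sum>j\<in>?j ` {..2 * n + 1}. if e j = i then w j else 0)"
    using J by (intro sum.mono_neutral_cong_left) auto
  also have "\<dots> = (\<Sum>k\<le>2 * n + 1. if e (?j k) = i then w (?j k) else 0)"
    by (subst sum.reindex) (auto simp: inj_on_def)
  also have "\<dots> = (\<Sum>k\<le>2 * n + 1. (euler d * ?b k * (fps_const (w (?j k)) * fps_X ^ e (?j k))) $ i)"
    using * by (intro sum.cong) auto
  finally show "theta w e $ i = (euler d * (\<Sum>k\<le>2 * n + 1. ?b k
        * (fps_const (w (?j k)) * fps_X ^ e (?j k)))) $ i"
    by (simp only: sum_distrib_left fps_sum_nth mult.assoc)
qed

text \<open>Equal to \<open>(r j (j+1) + s j (j-1)) / 2\<close>, the exponent in Ramanujan's theta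
  function \<open>f(a, b)\<close> for \<open>a = q^r\<close>, \<open>b = q^s\<close>. The integer is
  never negative, so \<open>nat\<close> loses nothing.\<close>

definition theta_exp :: "nat \<Rightarrow> nat \<Rightarrow> int \<Rightarrow> nat" where
  "theta_exp r s j = nat (int r * j + int (r + s) * (j * (j - 1) div 2))"

lemma two_theta_exp: "2 * int (theta_exp r s j) = int r * (j * (j + 1)) + int s * (j * (j - 1))"
proof -
  have ev: "2 * (j * (j - 1) div 2) = j * (j - 1)" by (cases "even j") auto
  have "2 * (int r * j + int (r + s) * (j * (j - 1) div 2))
      = 2 * int r * j + int (r + s) * (2 * (j * (j - 1) div 2))" by (simp add: algebra_simps)
  also have "\<dots> = int r * (j * (j + 1)) + int s * (j * (j - 1))"
    unfolding ev by (simp add: algebra_simps)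
  finally have eq: "2 * (int r * j + int (r + s) * (j * (j - 1) div 2))
      = int r * (j * (j + 1)) + int s * (j * (j - 1))" .
  have "0 \<le> j * (j + 1)" "0 \<le> j * (j - 1)" by (auto simp: zero_le_mult_iff)
  then have "0 \<le> int r * (j * (j + 1)) + int s * (j * (j - 1))" by simp
  then have "0 \<le> int r * j + int (r + s) * (j * (j - 1) div 2)"
    unfolding eq[symmetric] by (simp only: zero_le_mult_iff) simp
  then show ?thesis using eq by (simp add: theta_exp_def)
qed

text \<open>The growth condition of \<open>theta_limit\<close>, later also the source of finite
  fibres. It comes from \<open>(\<bar>j\<bar> - 1) * (\<bar>j\<bar> - 2) \<ge> 0\<close> for
  integers \<open>j\<close>.\<close>

lemma theta_exp_ge:
  assumes "r + s > 0"
  shows "\<bar>j\<bar> \<le> int (theta_exp r s j) + 1"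
proof -
  have p: "0 \<le> j * (j + 1)" "0 \<le> j * (j - 1)" by (auto simp: zero_le_mult_iff)
  have q: "2 * \<bar>j\<bar> - 2 \<le> j * (j + 1)" "2 * \<bar>j\<bar> - 2 \<le> j * (j - 1)"
  proof -
    have 1: "0 \<le> (\<bar>j\<bar> - 1) * (\<bar>j\<bar> - 2)" by (auto simp: zero_le_mult_iff)
    have "(\<bar>j\<bar> - 1) * (\<bar>j\<bar> - 2) = j * j - 3 * \<bar>j\<bar> + 2" by (simp add: algebra_simps)
    then show "2 * \<bar>j\<bar> - 2 \<le> j * (j + 1)" "2 * \<bar>j\<bar> - 2 \<le> j * (j - 1)"
      using 1 by (simp_all add: algebra_simps)
  qed
  have "int r * (j * (j + 1)) \<ge> j * (j + 1) \<or> int s * (j * (j - 1)) \<ge> j * (j - 1)"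
  proof (cases "r > 0")
    case True
    then show ?thesis using mult_right_mono[of 1 "int r", OF _ p(1)] by simp
  next
    case False
    then show ?thesis using assms mult_right_mono[of 1 "int s", OF _ p(2)] by simp
  qed
  moreover have "int r * (j * (j + 1)) \<ge> 0" "int s * (j * (j - 1)) \<ge> 0" using p by simp_all
  ultimately have "2 * \<bar>j\<bar> - 2 \<le> 2 * int (theta_exp r s j)"
    using q unfolding two_theta_exp by linarith
  then show ?thesis by linarith
qed

lemma two_choose_two: "2 * int (k choose 2) = int k * (int k - 1)"
  by (induction k) (simp_all add: Suc_choose_two numeral_2_eq_2 algebra_simps)

text \<open>Degree of the \<open>k\<close>-th term in the q-binomial expansion for the triple
  product, split into a constant free of \<open>k\<close> and the theta exponent of
  \<open>k - n\<close>.\<close>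

lemma theta_exp_shift:
  assumes "k \<le> 2 * n + 1"
  shows "(r + s) * (k choose 2) + (r + s) * n * (2 * n + 1 - k) + r * k
       = r * n + (r + s) * ((n choose 2) + n * (n + 1)) + theta_exp r s (int k - int n)"
proof -
  have "2 * int ((r + s) * (k choose 2) + (r + s) * n * (2 * n + 1 - k) + r * k)
     = int (r + s) * (2 * int (k choose 2)) + 2 * (int (r + s) * int n * (2 * int n + 1 - int k) + int r * int k)"
    unfolding of_nat_add[of _ "_ * k"] of_nat_add[of _ "_ * (_ - k)"] of_nat_mult of_nat_diff[OF assms]
    by (simp add: algebra_simps)
  also have "\<dots> = 2 * int r * int n + int (r + s) * (2 * int (n choose 2) + 2 * int n * (int n + 1))
      + 2 * int (theta_exp r s (int k - int n))"
    unfolding two_choose_two two_theta_exp by (simp add: algebra_simps)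
  also have "\<dots> = 2 * int (r * n + (r + s) * ((n choose 2) + n * (n + 1)) + theta_exp r s (int k - int n))"
    by (simp add: algebra_simps)
  finally show ?thesis by (metis mult_cancel_left of_nat_eq_iff zero_neq_numeral)
qed

text \<open>Centres the one-sided product: since \<open>q^n = a * b * q^(n-k-1) * q^k\<close>, each
  of the first \<open>n\<close> factors, taken in reverse order, yields
  \<open>a * q^(n-k-1)\<close>; each of the other \<open>n + 1\<close> yields
  \<open>q^n\<close>.\<close>

lemma prod_symmetric_split:
  fixes a b q :: "'a::comm_ring_1"
  assumes "a * b = q"
  shows "(\<Prod>k<2 * n + 1. q ^ n + a * q ^ k)
       = a ^ n * q ^ ((n choose 2) + n * (n + 1)) * ((\<Prod>k<n. 1 + b * q ^ k) * (\<Prod>k<n + 1. 1 + a * q ^ k))"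
proof -
  have split: "(\<Prod>k<n + m. f k) = (\<Prod>k<n. f k) * (\<Prod>k<m. f (n + k))" for m and f :: "nat \<Rightarrow> 'a"
    by (induction m) (simp_all add: mult.assoc)
  have "(\<Prod>k<2 * n + 1. q ^ n + a * q ^ k)
      = (\<Prod>k<n. q ^ n + a * q ^ k) * (\<Prod>k<n + 1. q ^ n + a * q ^ (n + k))"
    using split[where m = "n + 1"] by (simp add: mult_2 add.assoc)
  also have "(\<Prod>k<n. q ^ n + a * q ^ k) = (\<Prod>k<n. a * q ^ (n - Suc k) * (1 + b * q ^ k))"
  proof (subst prod.nat_diff_reindex[symmetric], intro prod.cong refl)
    fix k assume "k \<in> {..<n}"
    then have "q ^ n = q * q ^ (n - Suc k) * q ^ k"
      by (simp flip: power_Suc power_add)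
    then have "q ^ n = a * b * q ^ (n - Suc k) * q ^ k"
      by (simp only: assms)
    then show "q ^ n + a * q ^ (n - Suc k) = a * q ^ (n - Suc k) * (1 + b * q ^ k)"
      by (simp add: algebra_simps)
  qed
  also have "\<dots> = a ^ n * q ^ (n choose 2) * (\<Prod>k<n. 1 + b * q ^ k)"
    using prod.nat_diff_reindex[of "\<lambda>k. q ^ k" n]
    by (simp add: prod.distrib prod_power_eq_choose_two)
  also have "(\<Prod>k<n + 1. q ^ n + a * q ^ (n + k)) = (\<Prod>k<n + 1. q ^ n * (1 + a * q ^ k))"
    by (intro prod.cong) (auto simp: power_add algebra_simps)
  also have "\<dots> = q ^ (n * (n + 1)) * (\<Prod>k<n + 1. 1 + a * q ^ k)"
    by (simp only: prod.distrib prod_constant card_lessThan power_mult)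
  finally show ?thesis by (simp only: power_add mult_ac)
qed

text \<open>With \<open>a = \<epsilon> q^r\<close> and \<open>b = \<epsilon> q^s\<close>, so that
  \<open>a * b = q^(r+s)\<close>, the centred product is expanded by the q-binomial theorem, a
  common monomial is cancelled, and \<open>theta_limit\<close> passes to the two-sided
  series.\<close>

theorem Jacobi_triple_product:
  assumes rs: "r + s > 0" and \<epsilon>: "\<epsilon> * \<epsilon> = 1" and n: "2 * m + 1 \<le> n"
  shows "fps_eq_upto m (theta (\<lambda>j. if even j then 1 else \<epsilon>) (theta_exp r s))
    (euler (r + s) * ((\<Prod>k<n. 1 + fps_const \<epsilon> * fps_X ^ (s + (r + s) * k))
                    * (\<Prod>k<n + 1. 1 + fps_const \<epsilon> * fps_X ^ (r + (r + s) * k))))"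
proof -
  define d where "d = r + s"
  let ?w = "\<lambda>j::int. if even j then 1 else \<epsilon>"
  let ?S = "\<Sum>k\<le>2 * n + 1. qbinomial (fps_X ^ d) (2 * n + 1) k
        * (fps_const (?w (int k - int n)) * fps_X ^ theta_exp r s (int k - int n))"
  define K where "K = r * n + d * ((n choose 2) + n * (n + 1))"
  \<comment> \<open>As \<open>\<epsilon>\<close> squares to 1, its powers depend only on the parity
    of the exponent; shifting the index by \<open>n\<close> costs the constant
    \<open>\<epsilon> ^ n\<close>.\<close>
  have pw: "\<epsilon> ^ k = \<epsilon> ^ n * ?w (int k - int n)" for k
  proof -
    have "\<epsilon> ^ k = ?w (int k)" for k using \<epsilon> by (induction k) auto
    then show ?thesis using \<epsilon> by auto
  qed
  define a b q :: "int fps" where "a = fps_const \<epsilon> * fps_X ^ r" and "b = fps_const \<epsilon> * fps_X ^ s"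
    and "q = fps_X ^ d"
  have ab: "a * b = q"
  proof -
    have "a * b = fps_const (\<epsilon> * \<epsilon>) * fps_X ^ d"
      by (simp add: a_def b_def d_def power_add mult_ac flip: fps_const_mult)
    then show ?thesis by (simp add: \<epsilon> q_def)
  qed
  have summand: "qbinomial q (2 * n + 1) k * q ^ (k choose 2) * a ^ k * (q ^ n) ^ (2 * n + 1 - k)
      = fps_const (\<epsilon> ^ n) * fps_X ^ K * (qbinomial q (2 * n + 1) k
        * (fps_const (?w (int k - int n)) * fps_X ^ theta_exp r s (int k - int n)))"
    if "k \<le> 2 * n + 1" for k
  proof -
    have "q ^ (k choose 2) * a ^ k * (q ^ n) ^ (2 * n + 1 - k)
       = fps_const (\<epsilon> ^ k) * fps_X ^ (d * (k choose 2) + d * n * (2 * n + 1 - k) + r * k)"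
      by (simp add: q_def a_def power_mult_distrib power_add fps_const_power mult_ac flip: power_mult)
    also have "\<dots> = fps_const (\<epsilon> ^ n) * fps_X ^ K * (fps_const (?w (int k - int n)) * fps_X ^ theta_exp r s (int k - int n))"
      unfolding theta_exp_shift[OF that, of r s, folded d_def] K_def[symmetric] pw[of k]
      by (simp only: power_add fps_const_mult[symmetric] mult_ac)
    finally have "qbinomial q (2 * n + 1) k * (q ^ (k choose 2) * a ^ k * (q ^ n) ^ (2 * n + 1 - k))
      = qbinomial q (2 * n + 1) k * (fps_const (\<epsilon> ^ n) * fps_X ^ K
          * (fps_const (?w (int k - int n)) * fps_X ^ theta_exp r s (int k - int n)))"
      by (rule arg_cong)
    then show ?thesis by (simp only: mult_ac)
  qed
  have "fps_const (\<epsilon> ^ n) * fps_X ^ K * ?S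
      = (\<Sum>k\<le>2 * n + 1. qbinomial q (2 * n + 1) k * q ^ (k choose 2) * a ^ k * (q ^ n) ^ (2 * n + 1 - k))"
    unfolding sum_distrib_left q_def[symmetric] by (intro sum.cong) (simp_all only: summand atMost_iff)
  also have "\<dots> = a ^ n * q ^ ((n choose 2) + n * (n + 1)) * ((\<Prod>k<n. 1 + b * q ^ k) * (\<Prod>k<n + 1. 1 + a * q ^ k))"
    by (simp only: qbinomial_theorem[symmetric] prod_symmetric_split[OF ab])
  also have "a ^ n * q ^ ((n choose 2) + n * (n + 1)) = fps_const (\<epsilon> ^ n) * fps_X ^ K"
    by (simp add: a_def q_def K_def power_mult_distrib power_add distrib_left fps_const_power mult_ac flip: power_mult)
  finally have "fps_const (\<epsilon> ^ n) * fps_X ^ K * ?S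
      = fps_const (\<epsilon> ^ n) * fps_X ^ K * ((\<Prod>k<n. 1 + b * q ^ k) * (\<Prod>k<n + 1. 1 + a * q ^ k))" .
  moreover have "\<epsilon> \<noteq> 0" using \<epsilon> by fastforce
  then have "fps_const (\<epsilon> ^ n) * fps_X ^ K \<noteq> 0" by simp
  ultimately have "?S = (\<Prod>k<n. 1 + b * q ^ k) * (\<Prod>k<n + 1. 1 + a * q ^ k)"
    by (simp only: mult_left_cancel not_False_eq_True)
  moreover have "b * q ^ k = fps_const \<epsilon> * fps_X ^ (s + d * k)" for k
    by (simp add: b_def q_def power_add mult.assoc flip: power_mult)
  moreover have "a * q ^ k = fps_const \<epsilon> * fps_X ^ (r + d * k)" for k
    by (simp add: a_def q_def power_add mult.assoc flip: power_mult)
  ultimately show ?thesis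
    using theta_limit[OF rs theta_exp_ge[OF rs] n, of ?w] by (simp only: d_def)
qed

section \<open>Jacobi's identity for the cube and the theta products\<close>

lemma qbinomial_const_poly: "qbinomial [:q:] n k = [:qbinomial q n k:]"
  by (induction q n k rule: qbinomial.induct) (simp_all add: poly_const_pow one_pCons)

text \<open>For \<open>r = 0\<close> and sign -1 the triple product is \<open>0 = 0\<close>, because
  one factor vanishes. The information lies in the derivative: a variable \<open>z\<close> is
  introduced, and the product is differentiated at its simple zero \<open>z = 1\<close>.\<close>

lemma jacobi_cube_finite:
  fixes n :: nat
  defines "e \<equiv> theta_exp 0 1"
  shows "(\<Sum>k\<le>2 * n + 1. qbinomial fps_X (2 * n + 1) k
      * (fps_const ((if even (int k - int n) then 1 else -1) * (2 * (int k - int n) - 1))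
         * fps_X ^ e (int k - int n))) = - 2 * euler_prod 1 n ^ 2"
proof -
  let ?X = "fps_X :: int fps"
  define N where "N = 2 * n + 1"
  define c where "c k = qbinomial ?X N k * ?X ^ (k choose 2) * (-1) ^ k * (?X ^ n) ^ (N - k)" for k
  \<comment> \<open>The polynomial \<open>X^n - z X^k\<close> in \<open>z\<close>, with power series
    as coefficients; \<open>f n = X^n (1 - z)\<close> carries the zero.\<close>
  define f where "f k = [:?X ^ n, - (?X ^ k):]" for k
  have split: "(\<Prod>k<n + m. f k) = (\<Prod>k<n. f k) * (\<Prod>k<m. f (n + k))" for m
    by (induction m) (simp_all add: mult.assoc)
  have "(\<Prod>k<N. f k) = (\<Prod>k<N. [:?X ^ n:] + [:0, -1:] * [:?X:] ^ k)"
    by (intro prod.cong) (simp_all add: f_def poly_const_pow)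
  also have "\<dots> = (\<Sum>k\<le>N. qbinomial [:?X:] N k * [:?X:] ^ (k choose 2) * [:0, -1:] ^ k * [:?X ^ n:] ^ (N - k))"
    by (rule qbinomial_theorem)
  also have "\<dots> = (\<Sum>k\<le>N. monom (c k) k)"
  proof (intro sum.cong refl)
    fix k
    have "[:0, -1 :: int fps:] = smult (-1) (monom 1 1)" by (simp add: monom_altdef)
    then have "[:0, -1 :: int fps:] ^ k = monom ((-1) ^ k) k"
      by (simp only: smult_power[symmetric] monom_power smult_monom) simp
    then show "qbinomial [:?X:] N k * [:?X:] ^ (k choose 2) * [:0, -1:] ^ k * [:?X ^ n:] ^ (N - k) = monom (c k) k"
      by (simp add: qbinomial_const_poly poly_const_pow c_def smult_monom mult_ac)
  qed
  finally have expand: "(\<Prod>k<N. f k) = (\<Sum>k\<le>N. monom (c k) k)" .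
  have factor: "(\<Prod>k<N. f k) = (\<Prod>k<n. f k) * (f n * (\<Prod>k<n. f (n + Suc k)))"
    using split[of "Suc n"] unfolding prod.lessThan_Suc_shift by (simp add: N_def mult_2)
  have L: "poly (\<Prod>k<n. f k) 1 = (-1) ^ n * ?X ^ (n choose 2) * euler_prod 1 n"
  proof -
    have "poly (\<Prod>k<n. f k) 1 = (\<Prod>k<n. ?X ^ n - ?X ^ k)"
      by (simp add: poly_prod f_def)
    also have "\<dots> = (\<Prod>k<n. ?X ^ n - ?X ^ (n - Suc k))"
      by (rule prod.nat_diff_reindex[symmetric])
    also have "\<dots> = (\<Prod>k<n. (-1) * ?X ^ (n - Suc k) * (1 - ?X ^ (1 * Suc k)))"
    proof (intro prod.cong refl)
      fix k assume "k \<in> {..<n}"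
      then have "?X ^ n = ?X ^ (n - Suc k) * ?X ^ Suc k" by (simp flip: power_Suc power_add)
      then show "?X ^ n - ?X ^ (n - Suc k) = (-1) * ?X ^ (n - Suc k) * (1 - ?X ^ (1 * Suc k))"
        by (simp add: algebra_simps)
    qed
    also have "\<dots> = (-1) ^ n * ?X ^ (n choose 2) * euler_prod 1 n"
      using prod.nat_diff_reindex[of "\<lambda>k. ?X ^ k" n]
      by (simp only: prod.distrib prod_constant card_lessThan prod_power_eq_choose_two euler_prod_def)
    finally show ?thesis .
  qed
  have R: "poly (\<Prod>k<n. f (n + Suc k)) 1 = ?X ^ (n * n) * euler_prod 1 n"
  proof -
    have "poly (\<Prod>k<n. f (n + Suc k)) 1 = (\<Prod>k<n. ?X ^ n * (1 - ?X ^ (1 * Suc k)))"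
      by (simp add: poly_prod f_def power_add algebra_simps)
    then show ?thesis
      by (simp only: prod.distrib prod_constant card_lessThan euler_prod_def power_mult)
  qed
  have zero: "(\<Sum>k\<le>N. c k) = 0"
    using arg_cong[OF expand, of "\<lambda>p. poly p 1"] unfolding factor
    by (simp add: poly_sum poly_monom f_def)
  \<comment> \<open>In the product rule only the term that differentiates \<open>f n\<close>
    survives at \<open>z = 1\<close>.\<close>
  have "poly (pderiv (\<Prod>k<N. f k)) 1 = - (?X ^ n) * (poly (\<Prod>k<n. f k) 1 * poly (\<Prod>k<n. f (n + Suc k)) 1)"
    unfolding factor pderiv_mult by (simp add: f_def pderiv_pCons algebra_simps)
  moreover have "poly (pderiv (\<Prod>k<N. f k)) 1 = (\<Sum>k\<le>N. of_nat k * c k)"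
    unfolding expand higher_pderiv_sum[of 1, simplified] by (simp add: poly_sum pderiv_monom poly_monom)
  ultimately have deriv: "(\<Sum>k\<le>N. of_nat k * c k)
      = - ((-1) ^ n * ?X ^ ((n choose 2) + n * (n + 1)) * euler_prod 1 n ^ 2)"
    unfolding L R by (simp add: power_add power2_eq_square mult_ac)
  define S where "S = (\<Sum>k\<le>N. qbinomial ?X N k
      * (fps_const ((if even (int k - int n) then 1 else -1) * (2 * (int k - int n) - 1))
         * ?X ^ e (int k - int n)))"
  \<comment> \<open>Because the plain sum of \<open>c\<close> is 0, the weight \<open>k\<close> may
    be replaced by \<open>2 k - N = 2 (k - n) - 1\<close>, which depends only on the shifted
    index.\<close>
  have summand: "(2 * of_nat k - of_nat N) * c k = (-1) ^ n * ?X ^ ((n choose 2) + n * (n + 1))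
      * (qbinomial ?X N k * (fps_const ((if even (int k - int n) then 1 else -1) * (2 * (int k - int n) - 1))
         * ?X ^ e (int k - int n)))" if "k \<le> N" for k
  proof -
    have pX: "?X ^ (k choose 2) * (?X ^ n) ^ (N - k)
        = ?X ^ ((n choose 2) + n * (n + 1)) * ?X ^ e (int k - int n)"
      using theta_exp_shift[of k n 0 1] that by (simp add: e_def N_def flip: power_mult power_add)
    have sgn: "(-1 :: int fps) ^ k = (-1) ^ n * fps_const (if even (int k - int n) then 1 else -1)"
      by (auto simp: minus_one_power_iff simp flip: fps_const_neg)
    have wt: "(2 * of_nat k - of_nat N :: int fps) = fps_const (2 * (int k - int n) - 1)"
      by (simp add: N_def fps_of_nat[symmetric] fps_numeral_fps_const algebra_simps)
    have "(2 * of_nat k - of_nat N) * c k = (2 * of_nat k - of_nat N) * (qbinomial ?X N k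
       * (-1) ^ k * (?X ^ (k choose 2) * (?X ^ n) ^ (N - k)))"
      by (simp only: c_def mult_ac)
    also have "\<dots> = (-1) ^ n * ?X ^ ((n choose 2) + n * (n + 1))
      * (qbinomial ?X N k * (fps_const (if even (int k - int n) then 1 else -1)
          * fps_const (2 * (int k - int n) - 1) * ?X ^ e (int k - int n)))"
      unfolding pX sgn wt by (simp only: mult_ac)
    finally show ?thesis by (simp only: fps_const_mult)
  qed
  have "(-1) ^ n * ?X ^ ((n choose 2) + n * (n + 1)) * S = (\<Sum>k\<le>N. (2 * of_nat k - of_nat N) * c k)"
    unfolding S_def sum_distrib_left by (intro sum.cong refl) (simp only: summand atMost_iff)
  also have "\<dots> = 2 * (\<Sum>k\<le>N. of_nat k * c k) - of_nat N * (\<Sum>k\<le>N. c k)"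
    by (simp add: sum_distrib_left sum_subtractf left_diff_distrib mult.assoc)
  also have "\<dots> = (-1) ^ n * ?X ^ ((n choose 2) + n * (n + 1)) * (- 2 * euler_prod 1 n ^ 2)"
    unfolding zero deriv by (simp add: mult_ac)
  finally have "S = - 2 * euler_prod 1 n ^ 2"
    by (subst (asm) mult_left_cancel) auto
  then show ?thesis by (simp add: S_def N_def)
qed

text \<open>The sum runs over all integers, and \<open>j\<close> and \<open>1 - j\<close> contribute
  equally; hence the factor 2 relative to Jacobi's one-sided series.\<close>

theorem jacobi_cube:
  "theta (\<lambda>j. (if even j then 1 else -1) * (2 * j - 1)) (theta_exp 0 1) = - 2 * euler 1 ^ 3"
proof (rule fps_eqI_upto)
  fix m :: nat
  define n where "n = 2 * m + 1"
  have "fps_eq_upto m (theta (\<lambda>j. (if even j then 1 else -1) * (2 * j - 1)) (theta_exp 0 1))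
     (euler 1 * (- 2 * euler_prod 1 n ^ 2))"
    using theta_limit[of 1 "theta_exp 0 1" m n "\<lambda>j. (if even j then 1 else -1) * (2 * j - 1)"] theta_exp_ge[of 0 1]
    unfolding power_one_right jacobi_cube_finite by (simp add: n_def)
  also have "fps_eq_upto m \<dots> (euler 1 * (- 2 * euler 1 ^ 2))"
    by (intro fps_eq_upto_mult fps_eq_upto_power fps_eq_upto_refl fps_eq_upto_sym[OF euler_upto])
      (simp_all add: n_def)
  also have "euler 1 * (- 2 * euler 1 ^ 2) = - 2 * euler 1 ^ 3"
    by (simp add: power2_eq_square power3_eq_cube)
  finally show "fps_eq_upto m (theta (\<lambda>j. (if even j then 1 else -1) * (2 * j - 1)) (theta_exp 0 1))
    (- 2 * euler 1 ^ 3)" .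
qed

section \<open>Product formulas for three theta series\<close>

lemma one_plus_neg_const: "1 + fps_const (-1) * F = 1 - (F :: int fps)"
  by (simp add: fps_eq_iff)

lemma prod_odd_euler:
  "(\<Prod>k<n. 1 + fps_const (-1) * fps_X ^ (1 + 2 * k)) * euler_prod 2 n = euler_prod 1 (2 * n)"
proof (induction n)
  case (Suc n)
  have "euler_prod 1 (2 * Suc n) = euler_prod 1 (2 * n) * ((1 - fps_X ^ (1 + 2 * n)) * (1 - fps_X ^ (2 * Suc n)))"
    by (simp add: euler_prod_Suc)
  then show ?case
    unfolding Suc.IH[symmetric] euler_prod_Suc[of 2] prod.lessThan_Suc one_plus_neg_const
    by (simp only: mult_ac)
qed simp

text \<open>Gauss's product for the alternating sum over squares. For \<open>r = s = 1\<close> the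
  triple product is \<open>euler 2\<close> times the square of the product over odd exponents, and
  the latter times \<open>euler 2\<close> is \<open>euler 1\<close>.\<close>

theorem theta_phi_eq:
  "theta (\<lambda>j. if even j then 1 else -1) (theta_exp 1 1) * euler 2 = euler 1 ^ 2"
proof (rule fps_eqI_upto)
  fix m :: nat
  define n where "n = 2 * m + 1"
  define O1 :: "nat \<Rightarrow> int fps" where "O1 n = (\<Prod>k<n. 1 + fps_const (-1) * fps_X ^ (1 + 2 * k))" for n
  have O1: "fps_eq_upto m (euler 2 * O1 k) (euler 1)" if "m \<le> k" for k
  proof -
    have "fps_eq_upto m (euler 2 * O1 k) (euler_prod 2 k * O1 k)"
      using that by (intro fps_eq_upto_mult euler_upto) auto
    also have "\<dots> = euler_prod 1 (2 * k)"
      using prod_odd_euler[of k] by (simp add: O1_def mult.commute)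
    also have "fps_eq_upto m \<dots> (euler 1)"
      using that by (intro fps_eq_upto_sym[OF euler_upto]) auto
    finally show ?thesis .
  qed
  have "fps_eq_upto m (theta (\<lambda>j. if even j then 1 else -1) (theta_exp 1 1))
     (euler 2 * (O1 n * O1 (n + 1)))"
    using Jacobi_triple_product[of 1 1 "-1" m n] unfolding O1_def one_add_one by (simp add: n_def)
  then have "fps_eq_upto m (theta (\<lambda>j. if even j then 1 else -1) (theta_exp 1 1) * euler 2)
     ((euler 2 * (O1 n * O1 (n + 1))) * euler 2)"
    by (intro fps_eq_upto_mult) auto
  also have "\<dots> = (euler 2 * O1 n) * (euler 2 * O1 (n + 1))" by (simp only: mult_ac)
  also have "fps_eq_upto m \<dots> (euler 1 * euler 1)"
    by (intro fps_eq_upto_mult O1) (auto simp: n_def)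
  finally show "fps_eq_upto m (theta (\<lambda>j. if even j then 1 else -1) (theta_exp 1 1) * euler 2) (euler 1 ^ 2)"
    by (simp add: power2_eq_square)
qed

text \<open>Inclusion-exclusion: exponents congruent to 1 or 5 modulo 6 are those prime to 6, and
  the multiples of 2 and of 3 together count the multiples of 6 twice.\<close>

lemma prod_mod_6_euler:
  "(\<Prod>k<n. 1 + fps_const (-1) * fps_X ^ (5 + 6 * k)) * (\<Prod>k<n. 1 + fps_const (-1) * fps_X ^ (1 + 6 * k))
     * (euler_prod 2 (3 * n) * euler_prod 3 (2 * n)) = euler_prod 1 (6 * n) * euler_prod 6 n"
proof (induction n)
  case (Suc n)
  define x :: "nat \<Rightarrow> int fps" where "x i = 1 - fps_X ^ (i + 6 * n)" for i
  have 1: "euler_prod 1 (6 * Suc n) = euler_prod 1 (6 * n) * (x 1 * x 2 * x 3 * x 4 * x 5 * x 6)"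
    by (simp add: x_def numeral_eq_Suc euler_prod_Suc mult.assoc)
  have 2: "euler_prod 2 (3 * Suc n) = euler_prod 2 (3 * n) * (x 2 * x 4 * x 6)"
  proof -
    have "3 * Suc n = Suc (Suc (Suc (3 * n)))" by simp
    then have "euler_prod 2 (3 * Suc n) = euler_prod 2 (3 * n) * ((1 - fps_X ^ (2 * Suc (3 * n)))
       * (1 - fps_X ^ (2 * Suc (Suc (3 * n)))) * (1 - fps_X ^ (2 * Suc (Suc (Suc (3 * n))))))"
      by (simp only: euler_prod_Suc mult.assoc)
    moreover have "2 * Suc (3 * n) = 2 + 6 * n" "2 * Suc (Suc (3 * n)) = 4 + 6 * n"
      "2 * Suc (Suc (Suc (3 * n))) = 6 + 6 * n" by simp_all
    ultimately show ?thesis by (simp only: x_def)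
  qed
  have 3: "euler_prod 3 (2 * Suc n) = euler_prod 3 (2 * n) * (x 3 * x 6)"
  proof -
    have "2 * Suc n = Suc (Suc (2 * n))" by simp
    then have "euler_prod 3 (2 * Suc n) = euler_prod 3 (2 * n) * ((1 - fps_X ^ (3 * Suc (2 * n)))
       * (1 - fps_X ^ (3 * Suc (Suc (2 * n)))))"
      by (simp only: euler_prod_Suc mult.assoc)
    moreover have "3 * Suc (2 * n) = 3 + 6 * n" "3 * Suc (Suc (2 * n)) = 6 + 6 * n" by simp_all
    ultimately show ?thesis by (simp only: x_def)
  qed
  have 6: "euler_prod 6 (Suc n) = euler_prod 6 n * x 6"
    by (simp add: x_def euler_prod_Suc)
  define P Q where "P = (\<Prod>k<n. 1 + fps_const (-1) * fps_X ^ (5 + 6 * k) :: int fps)"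
    and "Q = (\<Prod>k<n. 1 + fps_const (-1) * fps_X ^ (1 + 6 * k) :: int fps)"
  have P: "(\<Prod>k<Suc n. 1 + fps_const (-1) * fps_X ^ (5 + 6 * k)) = P * x 5"
    by (simp only: P_def x_def prod.lessThan_Suc one_plus_neg_const)
  have Q: "(\<Prod>k<Suc n. 1 + fps_const (-1) * fps_X ^ (1 + 6 * k)) = Q * x 1"
    by (simp only: Q_def x_def prod.lessThan_Suc one_plus_neg_const)
  have "P * x 5 * (Q * x 1) * (euler_prod 2 (3 * n) * (x 2 * x 4 * x 6) * (euler_prod 3 (2 * n) * (x 3 * x 6)))
      = P * Q * (euler_prod 2 (3 * n) * euler_prod 3 (2 * n)) * (x 1 * x 2 * x 3 * x 4 * x 5 * x 6) * x 6"
    by (simp only: mult_ac)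
  also have "\<dots> = euler_prod 1 (6 * n) * (x 1 * x 2 * x 3 * x 4 * x 5 * x 6) * (euler_prod 6 n * x 6)"
    unfolding P_def Q_def Suc.IH by (simp only: mult_ac)
  finally show ?case unfolding 1 2 3 6 P Q .
qed simp

theorem theta_omega_eq:
  "theta (\<lambda>j. if even j then 1 else -1) (theta_exp 1 5) * (euler 2 * euler 3) = euler 1 * euler 6 ^ 2"
proof (rule fps_eqI_upto)
  fix m :: nat
  define n where "n = 2 * m + 1"
  let ?P = "\<lambda>n. \<Prod>k<n. 1 + fps_const (-1) * fps_X ^ (5 + 6 * k) :: int fps"
  let ?Q = "\<lambda>n. \<Prod>k<n. 1 + fps_const (-1) * fps_X ^ (1 + 6 * k) :: int fps"
  let ?w = "\<lambda>j::int. if even j then 1 else -1 :: int"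
  have "fps_eq_upto m (theta ?w (theta_exp 1 5)) (euler 6 * (?P n * ?Q (n + 1)))"
    using Jacobi_triple_product[of 1 5 "-1" m n] by (simp add: n_def)
  then have "fps_eq_upto m (theta ?w (theta_exp 1 5) * (euler 2 * euler 3))
     (euler 6 * (?P n * ?Q (n + 1)) * (euler_prod 2 (3 * n) * euler_prod 3 (2 * n)))"
    by (intro fps_eq_upto_mult euler_upto) (auto simp: n_def)
  \<comment> \<open>The second product has one factor more than the first; it extends
    \<open>euler_prod 1 (6 * n)\<close> by one factor.\<close>
  also have "euler 6 * (?P n * ?Q (n + 1)) * (euler_prod 2 (3 * n) * euler_prod 3 (2 * n))
     = euler 6 * (1 + fps_const (-1) * fps_X ^ (1 + 6 * n))
         * (?P n * ?Q n * (euler_prod 2 (3 * n) * euler_prod 3 (2 * n)))"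
    by (simp only: Suc_eq_plus1[symmetric] prod.lessThan_Suc mult_ac)
  also have "\<dots> = euler 6 * euler_prod 1 (6 * n + 1) * euler_prod 6 n"
    unfolding prod_mod_6_euler one_plus_neg_const[of "fps_X ^ (1 + 6 * n)"]
    by (simp add: euler_prod_Suc mult_ac)
  also have "fps_eq_upto m \<dots> (euler 6 * euler 1 * euler 6)"
    by (intro fps_eq_upto_mult fps_eq_upto_refl fps_eq_upto_sym[OF euler_upto]) (auto simp: n_def)
  finally show "fps_eq_upto m (theta ?w (theta_exp 1 5) * (euler 2 * euler 3)) (euler 1 * euler 6 ^ 2)"
    by (simp add: power2_eq_square mult_ac)
qed

lemma prod_plus_euler: "(\<Prod>k<n. 1 + fps_X ^ Suc k) * euler_prod 1 n = euler_prod 2 n"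
proof (induction n)
  case (Suc n)
  have "1 - fps_X ^ (2 * Suc n) = (1 + fps_X ^ Suc n) * (1 - fps_X ^ (1 * Suc n) :: int fps)"
    by (simp add: algebra_simps mult_2 flip: power_add)
  then show ?case unfolding euler_prod_Suc Suc.IH[symmetric] prod.lessThan_Suc by (simp only: mult_ac)
qed simp

text \<open>Each triangular number arises from both \<open>j\<close> and \<open>1 - j\<close>. On
  the product side the matching 2 is the factor \<open>1 + q^0\<close>.\<close>

theorem theta_psi_eq: "theta (\<lambda>j. 1) (theta_exp 0 1) * euler 1 = 2 * euler 2 ^ 2"
proof (rule fps_eqI_upto)
  fix m :: nat
  define n where "n = 2 * m + 1"
  let ?P = "\<Prod>k<n. 1 + fps_X ^ Suc k :: int fps"
  have Q: "(\<Prod>k<n + 1. 1 + fps_X ^ k) = 2 * ?P"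
    by (simp only: Suc_eq_plus1[symmetric] prod.lessThan_Suc_shift) simp
  have "fps_eq_upto m (theta (\<lambda>j. 1) (theta_exp 0 1)) (euler 1 * (?P * (\<Prod>k<n + 1. 1 + fps_X ^ k)))"
    using Jacobi_triple_product[of 0 1 1 m n] by (simp add: n_def del: power_Suc)
  then have "fps_eq_upto m (theta (\<lambda>j. 1) (theta_exp 0 1) * euler 1) (euler 1 * (?P * (2 * ?P)) * euler 1)"
    unfolding Q by (intro fps_eq_upto_mult) auto
  also have "fps_eq_upto m \<dots> (euler_prod 1 n * (?P * (2 * ?P)) * euler_prod 1 n)"
    by (intro fps_eq_upto_mult euler_upto fps_eq_upto_refl) (auto simp: n_def)
  also have "euler_prod 1 n * (?P * (2 * ?P)) * euler_prod 1 n = 2 * (?P * euler_prod 1 n) ^ 2"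
    by (simp only: power2_eq_square mult_ac)
  also have "\<dots> = 2 * euler_prod 2 n ^ 2" by (simp only: prod_plus_euler)
  also have "fps_eq_upto m \<dots> (2 * euler 2 ^ 2)"
    by (intro fps_eq_upto_mult fps_eq_upto_power fps_eq_upto_refl fps_eq_upto_sym[OF euler_upto]) (auto simp: n_def)
  finally show "fps_eq_upto m (theta (\<lambda>j. 1) (theta_exp 0 1) * euler 1) (2 * euler 2 ^ 2)" .
qed

section \<open>The trisection of the reciprocal of phi\<close>

lemma fps_trisection:
  fixes F :: "int fps"
  shows "F = (fps_section 3 0 F oo fps_X ^ 3) + fps_X * (fps_section 3 1 F oo fps_X ^ 3)
           + fps_X ^ 2 * (fps_section 3 2 F oo fps_X ^ 3)" (is "F = ?R")
proof (rule fps_ext)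
  fix n :: nat
  have "n mod 3 < 3" by simp
  then consider "n mod 3 = 0" | "n mod 3 = 1" | "n mod 3 = 2" by linarith
  then show "F $ n = ?R $ n"
  proof cases
    case 1
    then obtain k where "n = 3 * k" by auto
    moreover have "\<not> 3 dvd 3 * k - 1" if "k > 0" using that by presburger
    moreover have "\<not> 3 dvd 3 * k - 2" if "k > 0" using that by presburger
    ultimately show ?thesis
      by (auto simp: fps_compose_X_power_nth fps_section_def fps_X_power_mult_nth)
  next
    case 2
    then obtain k where "n = 3 * k + 1" by (metis mult_div_mod_eq)
    moreover have "\<not> 3 dvd 3 * k + 1" by presburger
    moreover have "\<not> 3 dvd 3 * k + 1 - 2" if "k > 0" using that by presburger
    ultimately show ?thesis
      by (auto simp: fps_compose_X_power_nth fps_section_def fps_X_power_mult_nth)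
  next
    case 3
    then obtain k where "n = 3 * k + 2" by (metis mult_div_mod_eq)
    moreover have "\<not> 3 dvd 3 * k + 1" "\<not> 3 dvd 3 * k + 2" by presburger+
    ultimately show ?thesis
      by (auto simp: fps_compose_X_power_nth fps_section_def fps_X_power_mult_nth)
  qed
qed

lemma fps_section_3_X:
  fixes F :: "int fps"
  shows "fps_section 3 0 (F * fps_X) = fps_X * fps_section 3 2 F"
    and "fps_section 3 1 (F * fps_X) = fps_section 3 0 F"
    and "fps_section 3 2 (F * fps_X) = fps_section 3 1 F"
proof -
  have "3 * n - 1 = 3 * (n - 1) + 2" if "n > 0" for n :: nat using that by simp
  then show "fps_section 3 0 (F * fps_X) = fps_X * fps_section 3 2 F"
    by (auto simp: fps_section_def fps_eq_iff)
qed (auto simp: fps_section_def fps_eq_iff)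

text \<open>Residue classes add modulo 3 under multiplication; each wrap-around past 2 costs one
  factor \<open>fps_X\<close>.\<close>

lemma fps_section_3_mult:
  fixes F G :: "int fps"
  shows "fps_section 3 0 (F * G) = fps_section 3 0 F * fps_section 3 0 G
      + fps_X * (fps_section 3 1 F * fps_section 3 2 G + fps_section 3 2 F * fps_section 3 1 G)"
    and "fps_section 3 1 (F * G) = fps_section 3 0 F * fps_section 3 1 G
      + fps_section 3 1 F * fps_section 3 0 G + fps_X * (fps_section 3 2 F * fps_section 3 2 G)"
    and "fps_section 3 2 (F * G) = fps_section 3 0 F * fps_section 3 2 G
      + fps_section 3 1 F * fps_section 3 1 G + fps_section 3 2 F * fps_section 3 0 G"
proof -
  have "F * G = F * (fps_section 3 0 G oo fps_X ^ 3) + (F * fps_X) * (fps_section 3 1 G oo fps_X ^ 3)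
           + (F * fps_X * fps_X) * (fps_section 3 2 G oo fps_X ^ 3)"
    by (subst fps_trisection[of G]) (simp add: distrib_left power2_eq_square mult.assoc)
  then have *: "fps_section 3 r (F * G) = fps_section 3 r F * fps_section 3 0 G
      + fps_section 3 r (F * fps_X) * fps_section 3 1 G
      + fps_section 3 r (F * fps_X * fps_X) * fps_section 3 2 G" if "r < 3" for r
    using that by (simp only: fps_section_add fps_section_mult_compose)
  show "fps_section 3 0 (F * G) = fps_section 3 0 F * fps_section 3 0 G
      + fps_X * (fps_section 3 1 F * fps_section 3 2 G + fps_section 3 2 F * fps_section 3 1 G)"
    using *[of 0] by (simp only: fps_section_3_X) (simp add: algebra_simps)
  show "fps_section 3 1 (F * G) = fps_section 3 0 F * fps_section 3 1 G
      + fps_section 3 1 F * fps_section 3 0 G + fps_X * (fps_section 3 2 F * fps_section 3 2 G)"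
    using *[of 1] by (simp only: fps_section_3_X) (simp add: algebra_simps)
  show "fps_section 3 2 (F * G) = fps_section 3 0 F * fps_section 3 2 G
      + fps_section 3 1 F * fps_section 3 1 G + fps_section 3 2 F * fps_section 3 0 G"
    using *[of 2] by (simp only: fps_section_3_X) (simp add: algebra_simps)
qed

section \<open>The cubic norm and the norm of Euler products\<close>

text \<open>With \<open>\<zeta>\<close> a primitive cube root of unity, \<open>norm3 F\<close> evaluated at \<open>q\<^sup>3\<close> is
  \<open>F(q) F(\<zeta> q) F(\<zeta>\<^sup>2 q)\<close>; expanding the product in the trisection of \<open>F\<close> keeps the coefficients integral.\<close>

definition norm3 :: "int fps \<Rightarrow> int fps" where
  "norm3 F = fps_section 3 0 F ^ 3 + fps_X * fps_section 3 1 F ^ 3 + fps_X ^ 2 * fps_section 3 2 F ^ 3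
     - 3 * fps_X * fps_section 3 0 F * fps_section 3 1 F * fps_section 3 2 F"

lemma norm3_mult: "norm3 (F * G) = norm3 F * norm3 G"
  unfolding norm3_def fps_section_3_mult by algebra

text \<open>Coefficient \<open>n\<close> of a section modulo 3 sits at index at most
  \<open>3 * n + 2\<close> of the original series.\<close>

lemma norm3_eq_upto:
  assumes "fps_eq_upto (3 * n + 2) F G"
  shows "fps_eq_upto n (norm3 F) (norm3 G)"
proof -
  have "fps_eq_upto n (fps_section 3 r F) (fps_section 3 r G)" if "r \<le> 2" for r
    using assms that by (auto simp: fps_eq_upto_def fps_section_def)
  then show ?thesis
    unfolding norm3_def
    by (intro fps_eq_upto_add fps_eq_upto_diff fps_eq_upto_mult fps_eq_upto_power fps_eq_upto_refl) auto
qed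

lemma fps_section_3_one_minus_X_power:
  assumes "r < 3"
  shows "fps_section 3 r (1 - fps_X ^ k :: int fps)
       = (if r = 0 then 1 else 0) - (if k mod 3 = r then fps_X ^ (k div 3) else 0)"
proof (rule fps_ext)
  fix n
  have "3 * n + r = k \<longleftrightarrow> k mod 3 = r \<and> n = k div 3" using assms by auto
  then show "fps_section 3 r (1 - fps_X ^ k :: int fps) $ n
      = ((if r = 0 then 1 else 0) - (if k mod 3 = r then fps_X ^ (k div 3) else 0)) $ n"
    by (auto simp: fps_section_def)
qed

text \<open>If 3 divides \<open>k\<close>, the three conjugates coincide and give a cube; otherwise
  they multiply to \<open>1 - q^(3k)\<close>, which is \<open>1 - q^k\<close> evaluated at
  \<open>q^3\<close>.\<close>

lemma norm3_one_minus_X_power: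
  "norm3 (1 - fps_X ^ k) = (if 3 dvd k then (1 - fps_X ^ (k div 3)) ^ 3 else 1 - fps_X ^ k)"
proof -
  have X: "(fps_X ^ k :: int fps) = fps_X ^ (k mod 3) * (fps_X ^ (k div 3)) ^ 3"
    by (simp only: power_mult[symmetric] power_add[symmetric] mult.commute[of _ 3] mod_mult_div_eq)
  have "k mod 3 < 3" by simp
  then consider "k mod 3 = 0" | "k mod 3 = 1" | "k mod 3 = 2" by linarith
  moreover have "fps_section 3 0 (1 - fps_X ^ k :: int fps) = 1 - (if k mod 3 = 0 then fps_X ^ (k div 3) else 0)"
    "fps_section 3 1 (1 - fps_X ^ k :: int fps) = - (if k mod 3 = 1 then fps_X ^ (k div 3) else 0)"
    "fps_section 3 2 (1 - fps_X ^ k :: int fps) = - (if k mod 3 = 2 then fps_X ^ (k div 3) else 0)"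
    by (simp_all add: fps_section_3_one_minus_X_power)
  ultimately show ?thesis
    unfolding norm3_def by cases (simp_all only:, use X in \<open>simp_all add: dvd_eq_mod_eq_0\<close>)
qed

text \<open>As 3 does not divide \<open>d\<close>, the norm fixes the factors of index prime to 3
  and turns the factor of exponent \<open>3 d i\<close> into \<open>(1 - q^(d i))^3\<close>;
  \<open>euler_prod (3 * d) n\<close> restores the factors so replaced.\<close>

lemma norm3_euler_prod:
  assumes "\<not> 3 dvd d"
  shows "norm3 (euler_prod d (3 * n)) * euler_prod (3 * d) n = euler_prod d (3 * n) * euler_prod d n ^ 3"
proof (induction n)
  case 0
  have "norm3 1 = 1" using norm3_mult[of "1 - fps_X" 1] norm3_one_minus_X_power[of 1] by simp
  then show ?case by simp
next
  case (Suc n)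
  define x :: "nat \<Rightarrow> int fps" where "x i = 1 - fps_X ^ (d * (3 * n + i))" for i
  have E: "euler_prod d (3 * Suc n) = euler_prod d (3 * n) * (x 1 * x 2 * x 3)"
    by (simp add: x_def numeral_eq_Suc euler_prod_Suc mult.assoc)
  have E3: "euler_prod (3 * d) (Suc n) = euler_prod (3 * d) n * x 3"
    by (simp add: x_def euler_prod_Suc algebra_simps)
  have ndvd: "\<not> 3 dvd d * (3 * n + 1)" "\<not> 3 dvd d * (3 * n + 2)"
  proof -
    have "\<not> 3 dvd 3 * n + 1" "\<not> 3 dvd 3 * n + 2" by presburger+
    moreover have "prime (3 :: nat)" by simp
    ultimately show "\<not> 3 dvd d * (3 * n + 1)" "\<not> 3 dvd d * (3 * n + 2)"
      using assms prime_dvd_mult_nat by blast+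
  qed
  have N: "norm3 (x 1) = x 1" "norm3 (x 2) = x 2"
    unfolding x_def norm3_one_minus_X_power using ndvd by auto
  have N3: "norm3 (x 3) = (1 - fps_X ^ (d * Suc n)) ^ 3"
  proof -
    have eq: "d * (3 * n + 3) = 3 * (d * Suc n)" by (simp add: algebra_simps)
    show ?thesis unfolding x_def eq norm3_one_minus_X_power by (simp del: mult_Suc_right)
  qed
  have "norm3 (euler_prod d (3 * Suc n)) * euler_prod (3 * d) (Suc n)
      = (norm3 (euler_prod d (3 * n)) * euler_prod (3 * d) n)
        * (x 1 * x 2 * x 3) * (1 - fps_X ^ (d * Suc n)) ^ 3"
    unfolding E E3 norm3_mult N N3 by (simp only: mult_ac)
  also have "\<dots> = euler_prod d (3 * Suc n) * euler_prod d (Suc n) ^ 3"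
    unfolding Suc.IH E euler_prod_Suc[of d n] by (simp only: power_mult_distrib mult_ac)
  finally show ?case .
qed

theorem norm3_euler:
  assumes "\<not> 3 dvd d"
  shows "norm3 (euler d) * euler (3 * d) = euler d ^ 4"
proof (rule fps_eqI_upto)
  fix n :: nat
  have d: "d > 0" using assms by (cases d) auto
  define N where "N = 3 * n + 2"
  have "fps_eq_upto n (norm3 (euler d) * euler (3 * d)) (norm3 (euler_prod d (3 * N)) * euler_prod (3 * d) N)"
    using d by (intro fps_eq_upto_mult norm3_eq_upto euler_upto) (auto simp: N_def)
  also have "\<dots> = euler_prod d (3 * N) * euler_prod d N ^ 3"
    by (rule norm3_euler_prod[OF assms])
  also have "fps_eq_upto n \<dots> (euler d * euler d ^ 3)"
    using d by (intro fps_eq_upto_mult fps_eq_upto_power fps_eq_upto_sym[OF euler_upto]) (auto simp: N_def)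
  finally show "fps_eq_upto n (norm3 (euler d) * euler (3 * d)) (euler d ^ 4)"
    by (simp add: power_numeral_reduce mult_ac)
qed

section \<open>Norm and sections of phi\<close>

abbreviation alt_sign :: "int \<Rightarrow> int" where
  "alt_sign j \<equiv> if even j then 1 else -1"

text \<open>The exponents of \<open>theta_omega\<close> are \<open>3 j^2 - 2 j\<close>. Summed over
  all integers, \<open>theta_psi\<close> is twice the one-sided sum over triangular numbers, and
  \<open>theta_cube\<close> is \<open>- 2 * euler 1 ^ 3\<close>.\<close>

definition theta_phi :: "int fps" where "theta_phi = theta alt_sign (theta_exp 1 1)"
definition theta_omega :: "int fps" where "theta_omega = theta alt_sign (theta_exp 1 5)"
definition theta_psi :: "int fps" where "theta_psi = theta (\<lambda>j. 1) (theta_exp 0 1)"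
definition theta_cube :: "int fps" where
  "theta_cube = theta (\<lambda>j. alt_sign j * (2 * j - 1)) (theta_exp 0 1)"

text \<open>The norm is applied to the product formula for \<open>theta_phi\<close>, with the norms
  of \<open>euler 1\<close> and \<open>euler 2\<close> taken from
  \<open>norm3_euler\<close>.\<close>

theorem norm3_theta_phi: "norm3 theta_phi * (euler 2 ^ 4 * euler 3 ^ 2) = euler 1 ^ 8 * euler 6"
proof -
  have "norm3 theta_phi * norm3 (euler 2) = norm3 (euler 1) ^ 2"
    using arg_cong[OF theta_phi_eq, of norm3] by (simp add: theta_phi_def norm3_mult power2_eq_square)
  moreover have "euler 2 ^ 4 = norm3 (euler 2) * euler 6" "euler 1 ^ 4 = norm3 (euler 1) * euler 3"
    using norm3_euler[of 2] norm3_euler[of 1] by simp_all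
  ultimately show ?thesis
    by algebra
qed

lemma theta_phi_exp: "int (theta_exp 1 1 j) = j * j"
  using two_theta_exp[of 1 1 j] by (simp add: algebra_simps)

lemma square_mod_3: "(x::int)\<^sup>2 mod 3 = (if 3 dvd x then 0 else 1)"
proof -
  have "0 \<le> x mod 3" "x mod 3 < 3" by simp_all
  then consider "x mod 3 = 0" | "x mod 3 = 1" | "x mod 3 = 2" by linarith
  then show ?thesis
    by cases (simp_all add: power2_eq_square dvd_eq_mod_eq_0 mod_mult_eq[of x 3 x, symmetric])
qed

text \<open>Squares are 0 or 1 modulo 3, and those that are 1 come from \<open>j = 3 i - 1\<close>
  and \<open>j = 1 - 3 i\<close>, where \<open>(3 i - 1)^2 = 3 (3 i^2 - 2 i) + 1\<close>. The two
  families give the factor 2; \<open>j\<close> and \<open>i\<close> differ in parity, which gives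
  the sign.\<close>

lemma fps_section_theta_phi:
  "fps_section 3 1 theta_phi = - 2 * theta_omega" "fps_section 3 2 theta_phi = 0"
proof -
  have exp_iff: "theta_exp 1 1 j = n \<longleftrightarrow> j * j = int n" for j n
    using theta_phi_exp[of j] by linarith
  have omega_iff: "theta_exp 1 5 i = n \<longleftrightarrow> (3 * i - 1) * (3 * i - 1) = 3 * int n + 1" for i n
  proof -
    have "(3 * i - 1) * (3 * i - 1) = 3 * int (theta_exp 1 5 i) + 1"
      using two_theta_exp[of 1 5 i] by (simp add: algebra_simps)
    then show ?thesis by linarith
  qed
  have sq_mod: "j * j mod 3 = (if 3 dvd j then 0 else 1)" for j :: int
    using square_mod_3[of j] by (simp only: power2_eq_square)
  show "fps_section 3 1 theta_phi = - 2 * theta_omega"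
  proof (rule fps_ext)
    fix n
    define S where "S = {i. theta_exp 1 5 i = n}"
    have fin: "finite S"
    proof (rule finite_subset)
      have "\<bar>i\<bar> \<le> int n + 1" if "i \<in> S" for i
        using theta_exp_ge[of 1 5 i] that by (simp add: S_def)
      then show "S \<subseteq> {- int n - 1..int n + 1}" by fastforce
    qed simp
    have "{j. theta_exp 1 1 j = 3 * n + 1} = (\<lambda>i. 3 * i - 1) ` S \<union> (\<lambda>i. 1 - 3 * i) ` S"
    proof (intro equalityI subsetI)
      fix j assume "j \<in> {j. theta_exp 1 1 j = 3 * n + 1}"
      then have j: "j * j = 3 * int n + 1" unfolding mem_Collect_eq exp_iff by simp
      then have "\<not> 3 dvd j" using sq_mod[of j] by presburger
      then have "(\<exists>i. j = 3 * i - 1) \<or> (\<exists>i. j = 1 - 3 * i)" by presburger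
      then obtain i where i: "j = 3 * i - 1 \<or> j = 1 - 3 * i" by blast
      then have "j * j = (3 * i - 1) * (3 * i - 1)" by algebra
      then have "i \<in> S" using j by (simp only: S_def mem_Collect_eq omega_iff)
      then show "j \<in> (\<lambda>i. 3 * i - 1) ` S \<union> (\<lambda>i. 1 - 3 * i) ` S"
        using i by blast
    next
      fix j assume "j \<in> (\<lambda>i. 3 * i - 1) ` S \<union> (\<lambda>i. 1 - 3 * i) ` S"
      then obtain i where "i \<in> S" and i: "j = 3 * i - 1 \<or> j = 1 - 3 * i" by blast
      then have "(3 * i - 1) * (3 * i - 1) = 3 * int n + 1"
        by (simp only: S_def mem_Collect_eq omega_iff)
      moreover have "j * j = (3 * i - 1) * (3 * i - 1)" using i by algebra
      ultimately show "j \<in> {j. theta_exp 1 1 j = 3 * n + 1}"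
        unfolding mem_Collect_eq exp_iff by simp
    qed
    moreover have "(\<lambda>i. 3 * i - 1) ` S \<inter> (\<lambda>i. 1 - 3 * i) ` S = {}"
    proof -
      have "3 * i - 1 \<noteq> 1 - 3 * i'" for i i' :: int by presburger
      then show ?thesis by auto
    qed
    ultimately have "(\<Sum>j | theta_exp 1 1 j = 3 * n + 1. alt_sign j)
       = (\<Sum>j\<in>(\<lambda>i. 3 * i - 1) ` S. alt_sign j) + (\<Sum>j\<in>(\<lambda>i. 1 - 3 * i) ` S. alt_sign j)"
      using fin by (simp only: sum.union_disjoint finite_imageI)
    also have "(\<Sum>j\<in>(\<lambda>i. 3 * i - 1) ` S. alt_sign j) = (\<Sum>i\<in>S. - alt_sign i)"
      by (subst sum.reindex) (auto simp: inj_on_def intro!: sum.cong)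
    also have "(\<Sum>j\<in>(\<lambda>i. 1 - 3 * i) ` S. alt_sign j) = (\<Sum>i\<in>S. - alt_sign i)"
      by (subst sum.reindex) (auto simp: inj_on_def intro!: sum.cong)
    finally show "fps_section 3 1 theta_phi $ n = (- 2 * theta_omega) $ n"
      by (simp add: fps_section_def theta_phi_def theta_omega_def theta_def S_def sum_negf
          numeral_fps_const flip: fps_const_neg)
  qed
  show "fps_section 3 2 theta_phi = 0"
  proof (rule fps_ext)
    fix n
    have "theta_exp 1 1 j \<noteq> 3 * n + 2" for j :: int
    proof
      assume "theta_exp 1 1 j = 3 * n + 2"
      then have "j * j = 3 * int n + 2" unfolding exp_iff by simp
      then have "j * j mod 3 = 2" by simp
      then show False using sq_mod[of j] by (simp split: if_splits)
    qed
    then show "fps_section 3 2 theta_phi $ n = 0 $ n"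
      by (simp add: fps_section_def theta_phi_def theta_def)
  qed
qed

text \<open>Here \<open>F = a + q b\<close>, and the cofactor, the product of the other two
  conjugates, comes from factoring the sum of cubes \<open>a^3 + (q b)^3\<close>.\<close>

lemma fps_norm3_adjugate:
  assumes "fps_section 3 2 F = 0"
  defines "a \<equiv> fps_section 3 0 F oo fps_X ^ 3" and "b \<equiv> fps_section 3 1 F oo fps_X ^ 3"
  shows "F * (a ^ 2 - fps_X * (a * b) + fps_X ^ 2 * b ^ 2) = norm3 F oo fps_X ^ 3"
proof -
  have X3: "(fps_X ^ 3 :: int fps) $ 0 = 0" by simp
  have "norm3 F oo fps_X ^ 3 = a ^ 3 + fps_X ^ 3 * b ^ 3"
    using assms(1) X3
    by (simp add: norm3_def a_def b_def fps_compose_add_distrib fps_compose_mult_distrib fps_compose_power[symmetric])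
  moreover have "F = a + fps_X * b"
    using fps_trisection[of F] assms(1) by (simp add: a_def b_def)
  ultimately show ?thesis by algebra
qed

text \<open>Multiplying \<open>F\<close> by the norm of \<open>theta_phi\<close>, a series in
  \<open>q^3\<close>, replaces division by \<open>theta_phi\<close> with a product by the cofactor.
  Its class 2 modulo 3 is the single term \<open>q^2 b^2\<close>; the product formulas then evaluate
  the result.\<close>

theorem trisection_of_inverse_phi:
  assumes F: "F * theta_phi = euler 15"
  shows "fps_section 3 2 F * euler 1 ^ 5 = - euler 5 * ((theta_cube oo fps_X ^ 6) * theta_psi)"
proof -
  define A where "A = fps_section 3 0 theta_phi"
  define C where "C = theta_omega"
  let ?X = "fps_X :: int fps"
  have X3: "(?X ^ 3) $ 0 = 0" by simp
  have sec1: "fps_section 3 1 theta_phi = - 2 * C" unfolding C_def by (rule fps_section_theta_phi)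
  have "F * (norm3 theta_phi oo ?X ^ 3) = euler 15 * ((A oo ?X ^ 3) ^ 2
      - ?X * ((A oo ?X ^ 3) * ((- 2 * C) oo ?X ^ 3)) + ?X ^ 2 * ((- 2 * C) oo ?X ^ 3) ^ 2)"
    unfolding fps_norm3_adjugate[OF fps_section_theta_phi(2), symmetric] F[symmetric] A_def sec1
    by (simp only: mult.assoc)
  \<comment> \<open>Since \<open>euler 15\<close> is \<open>euler 5\<close> at \<open>q^3\<close>,
    the right side is sorted into powers \<open>q^0, q^1, q^2\<close> times series in
    \<open>q^3\<close>.\<close>
  also have "\<dots> = 1 * ((euler 5 * A ^ 2) oo ?X ^ 3) + ?X ^ 1 * ((2 * euler 5 * A * C) oo ?X ^ 3)
      + ?X ^ 2 * ((4 * euler 5 * C ^ 2) oo ?X ^ 3)"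
    using X3 euler_compose[of 3 5]
    by (simp add: fps_compose_mult_distrib fps_compose_power[symmetric] fps_compose_uminus
        power_mult_distrib algebra_simps)
  finally have "fps_section 3 2 (F * (norm3 theta_phi oo ?X ^ 3)) = 4 * euler 5 * C ^ 2"
    using fps_section_X_power[of 2 3 0, where 'a = int] fps_section_X_power[of 2 3 1, where 'a = int]
      fps_section_X_power[of 2 3 2, where 'a = int]
    by (simp only: fps_section_add fps_section_mult_compose) (simp add: fps_section_mult_compose)
  then have G: "fps_section 3 2 F * norm3 theta_phi = 4 * euler 5 * C ^ 2"
    by (simp add: fps_section_mult_compose)
  have C: "C * (euler 2 * euler 3) = euler 1 * euler 6 ^ 2"
    using theta_omega_eq by (simp add: C_def theta_omega_def)
  have psi: "theta_psi * euler 1 = 2 * euler 2 ^ 2"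
    using theta_psi_eq by (simp add: theta_psi_def)
  have cube: "theta_cube oo fps_X ^ 6 = - 2 * euler 6 ^ 3"
    using euler_compose[of 6 1] unfolding theta_cube_def jacobi_cube
    by (simp add: fps_compose_mult_distrib fps_compose_power[symmetric] fps_compose_uminus)
  \<comment> \<open>The auxiliary factor completes \<open>euler 1 ^ 5\<close> to the right side of
    \<open>norm3_theta_phi\<close>; it is cancelled at the end.\<close>
  have "fps_section 3 2 F * euler 1 ^ 5 * (euler 1 ^ 3 * euler 6)
      = fps_section 3 2 F * (norm3 theta_phi * (euler 2 ^ 4 * euler 3 ^ 2))"
    unfolding norm3_theta_phi by (simp add: power_numeral_reduce mult_ac)
  also have "\<dots> = (2 * euler 5 * euler 6 ^ 3 * theta_psi) * (euler 1 ^ 3 * euler 6)"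
    using G C psi by algebra
  finally have "fps_section 3 2 F * euler 1 ^ 5 = 2 * euler 5 * euler 6 ^ 3 * theta_psi"
    by simp
  then show ?thesis unfolding cube by (simp add: mult_ac)
qed

section \<open>Generating functions of regular partitions\<close>

definition partitions_in :: "nat set \<Rightarrow> nat \<Rightarrow> nat multiset set" where
  "partitions_in D n = {\<alpha>. set_mset \<alpha> \<subseteq> D \<and> sum_mset \<alpha> = n}"

definition partitions_gf :: "nat set \<Rightarrow> int fps" where
  "partitions_gf D = Abs_fps (\<lambda>n. int (card (partitions_in D n)))"

lemma finite_partitions_in:
  assumes "0 \<notin> D"
  shows "finite (partitions_in D n)"
proof (rule finite_subset[OF _ finite_partitions_le])
  have "p > 0" if "p \<in> D" for p using assms that by (cases p) auto
  then show "partitions_in D n \<subseteq> {\<alpha>. partition_of \<alpha> \<and> sum_mset \<alpha> \<le> n}"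
    by (auto simp: partitions_in_def partition_of_def)
qed

lemma partitions_gf_empty: "partitions_gf {} = 1"
proof -
  have "partitions_in {} n = (if n = 0 then {{#}} else {})" for n
    by (auto simp: partitions_in_def)
  then show ?thesis by (simp add: partitions_gf_def fps_eq_iff)
qed

text \<open>A partition with parts in \<open>insert p D\<close> either avoids \<open>p\<close> or
  arises by adding one copy of \<open>p\<close> to such a partition of \<open>n - p\<close>.\<close>

lemma partitions_gf_insert:
  assumes "0 \<notin> insert p D" "p \<notin> D"
  shows "partitions_gf (insert p D) * (1 - fps_X ^ p) = partitions_gf D"
proof (rule fps_ext)
  fix n
  have fin: "finite (partitions_in (insert p D) n)" "finite (partitions_in D n)" for n
    using assms by (auto intro: finite_partitions_in)
  have "int (card (partitions_in (insert p D) n)) = int (card (partitions_in D n))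
      + (if n < p then 0 else int (card (partitions_in (insert p D) (n - p))))"
  proof (cases "n < p")
    case True
    have "partitions_in (insert p D) n = partitions_in D n"
    proof -
      have "p \<notin># \<alpha>" if "sum_mset \<alpha> = n" for \<alpha>
        using True that by (auto dest!: multi_member_split)
      then show ?thesis using assms(2) by (auto simp: partitions_in_def)
    qed
    then show ?thesis using True by simp
  next
    case False
    have "partitions_in (insert p D) n
        = partitions_in D n \<union> add_mset p ` partitions_in (insert p D) (n - p)"
    proof (intro equalityI subsetI)
      fix \<alpha> assume \<alpha>: "\<alpha> \<in> partitions_in (insert p D) n"
      show "\<alpha> \<in> partitions_in D n \<union> add_mset p ` partitions_in (insert p D) (n - p)"
      proof (cases "p \<in># \<alpha>")
        case True
        then obtain \<beta> where "\<alpha> = add_mset p \<beta>" by (auto dest: multi_member_split)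
        then show ?thesis using \<alpha> by (auto simp: partitions_in_def)
      next
        case False
        then show ?thesis using \<alpha> by (auto simp: partitions_in_def)
      qed
    qed (use False in \<open>auto simp: partitions_in_def\<close>)
    moreover have "partitions_in D n \<inter> add_mset p ` partitions_in (insert p D) (n - p) = {}"
    proof -
      have "add_mset p \<beta> \<notin> partitions_in D n" for \<beta>
        using assms(2) by (simp add: partitions_in_def)
      then show ?thesis by blast
    qed
    moreover have "card (add_mset p ` partitions_in (insert p D) (n - p)) = card (partitions_in (insert p D) (n - p))"
      by (intro card_image) (auto simp: inj_on_def)
    ultimately show ?thesis
      using False fin by (simp add: card_Un_disjoint)
  qed
  then show "(partitions_gf (insert p D) * (1 - fps_X ^ p)) $ n = partitions_gf D $ n"
    by (simp add: partitions_gf_def right_diff_distrib fps_X_power_mult_right_nth)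
qed

lemma partitions_gf_finite:
  assumes "finite D" "0 \<notin> D"
  shows "partitions_gf D * (\<Prod>p\<in>D. 1 - fps_X ^ p) = 1"
  using assms
proof (induction D rule: finite_induct)
  case empty
  then show ?case by (simp add: partitions_gf_empty)
next
  case (insert p D)
  have "partitions_gf (insert p D) * (\<Prod>p\<in>insert p D. 1 - fps_X ^ p)
      = (partitions_gf (insert p D) * (1 - fps_X ^ p)) * (\<Prod>p\<in>D. 1 - fps_X ^ p)"
    using insert.hyps by (simp add: mult.assoc)
  also have "\<dots> = 1"
    using insert partitions_gf_insert[of p D] by simp
  finally show ?case .
qed

lemma partitions_gf_upto:
  assumes "m \<le> M"
  shows "fps_eq_upto m (partitions_gf D) (partitions_gf (D \<inter> {..M}))"
proof -
  have "partitions_in D n = partitions_in (D \<inter> {..M}) n" if "n \<le> m" for n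
  proof -
    have "p \<le> M" if "p \<in># \<alpha>" "sum_mset \<alpha> = n" for p \<alpha>
      using that \<open>n \<le> m\<close> assms by (auto dest!: multi_member_split)
    then show ?thesis by (auto simp: partitions_in_def)
  qed
  then show ?thesis by (simp add: fps_eq_upto_def partitions_gf_def)
qed

theorem partitions_gf_regular:
  assumes "s > 0"
  shows "partitions_gf {p. p > 0 \<and> \<not> s dvd p} * euler 1 = euler s"
proof (rule fps_eqI_upto)
  fix m
  let ?D = "{p. p > 0 \<and> \<not> s dvd p}"
  have sm: "m \<le> s * m" using assms by (cases s) auto
  \<comment> \<open>The range stops at \<open>s * m\<close> so that its multiples of
    \<open>s\<close> are exactly the \<open>m\<close> exponents in
    \<open>euler_prod s m\<close>.\<close>
  have "{Suc 0..s * m} = (?D \<inter> {..s * m}) \<union> (\<lambda>k. s * Suc k) ` {..<m}"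
  proof (intro equalityI subsetI)
    fix p assume p: "p \<in> {Suc 0..s * m}"
    show "p \<in> (?D \<inter> {..s * m}) \<union> (\<lambda>k. s * Suc k) ` {..<m}"
    proof (cases "s dvd p")
      case True
      then obtain k where k: "p = s * k" by auto
      then have "k > 0" "k \<le> m" using p assms by auto
      then have "p = s * Suc (k - 1)" "k - 1 < m" using k by auto
      then show ?thesis by blast
    next
      case False
      then show ?thesis using p by auto
    qed
  next
    fix p assume "p \<in> (?D \<inter> {..s * m}) \<union> (\<lambda>k. s * Suc k) ` {..<m}"
    then show "p \<in> {Suc 0..s * m}"
    proof
      assume "p \<in> (\<lambda>k. s * Suc k) ` {..<m}"
      then obtain k where k: "p = s * Suc k" "k < m" by auto
      have "0 < s * Suc k" using assms by (simp del: mult_Suc_right)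
      moreover have "s * Suc k \<le> s * m" using k by (intro mult_le_mono2) auto
      ultimately show ?thesis unfolding k(1) atLeastAtMost_iff Suc_le_eq by blast
    qed auto
  qed
  moreover have "(?D \<inter> {..s * m}) \<inter> (\<lambda>k. s * Suc k) ` {..<m} = {}"
    by (auto simp del: mult_Suc_right)
  ultimately have "(\<Prod>p = Suc 0..s * m. 1 - fps_X ^ p :: int fps)
      = (\<Prod>p\<in>?D \<inter> {..s * m}. 1 - fps_X ^ p) * (\<Prod>p\<in>(\<lambda>k. s * Suc k) ` {..<m}. 1 - fps_X ^ p)"
    by (simp add: prod.union_disjoint)
  also have "(\<Prod>p\<in>(\<lambda>k. s * Suc k) ` {..<m}. 1 - fps_X ^ p :: int fps) = euler_prod s m"
    unfolding euler_prod_def using assms by (subst prod.reindex) (auto simp: inj_on_def)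
  also have "(\<Prod>p = Suc 0..s * m. 1 - fps_X ^ p :: int fps) = euler_prod 1 (s * m)"
    unfolding euler_prod_def
    by (rule prod.reindex_bij_witness[of _ "\<lambda>i. Suc i" "\<lambda>i. i - 1"]) auto
  finally have split: "euler_prod 1 (s * m) = (\<Prod>p\<in>?D \<inter> {..s * m}. 1 - fps_X ^ p) * euler_prod s m" .
  have "fps_eq_upto m (partitions_gf ?D * euler 1)
      (partitions_gf (?D \<inter> {..s * m}) * euler_prod 1 (s * m))"
    using sm by (intro fps_eq_upto_mult partitions_gf_upto euler_upto) auto
  also have "\<dots> = euler_prod s m"
    using partitions_gf_finite[of "?D \<inter> {..s * m}"] unfolding split by (simp flip: mult.assoc)
  also have "fps_eq_upto m \<dots> (euler s)"
    using assms by (intro fps_eq_upto_sym[OF euler_upto]) auto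
  finally show "fps_eq_upto m (partitions_gf ?D * euler 1) (euler s)" .
qed

text \<open>Bipartitions are sorted by the weight of the first component, which gives a Cauchy
  product of two one-component series.\<close>

theorem regular_bipartitions_gf:
  assumes "s > 0" "t > 0"
  shows "Abs_fps (\<lambda>n. int (B s t n)) * euler 1 ^ 2 = euler s * euler t"
proof -
  define D where "D s = {p. p > 0 \<and> \<not> s dvd p}" for s :: nat
  have fin: "finite (partitions_in (D s) n)" for s n
    by (intro finite_partitions_in) (simp add: D_def)
  have "Abs_fps (\<lambda>n. int (B s t n)) = partitions_gf (D s) * partitions_gf (D t)"
  proof (rule fps_ext)
    fix n
    have "regular_bipartitions s t n
        = (\<Union>k\<in>{0..n}. partitions_in (D s) k \<times> partitions_in (D t) (n - k))"
    proof (intro equalityI subsetI)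
      fix x assume x: "x \<in> regular_bipartitions s t n"
      obtain \<alpha> \<beta> where [simp]: "x = (\<alpha>, \<beta>)" by (cases x)
      have "sum_mset \<alpha> \<in> {0..n}"
        and "x \<in> partitions_in (D s) (sum_mset \<alpha>) \<times> partitions_in (D t) (n - sum_mset \<alpha>)"
        using x by (auto simp: regular_bipartitions_def partitions_in_def partition_of_def D_def)
      then show "x \<in> (\<Union>k\<in>{0..n}. partitions_in (D s) k \<times> partitions_in (D t) (n - k))" by blast
    next
      fix x assume "x \<in> (\<Union>k\<in>{0..n}. partitions_in (D s) k \<times> partitions_in (D t) (n - k))"
      then show "x \<in> regular_bipartitions s t n"
        by (auto simp: regular_bipartitions_def partitions_in_def partition_of_def D_def)
    qed
    moreover have "card (\<Union>k\<in>{0..n}. partitions_in (D s) k \<times> partitions_in (D t) (n - k))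
        = (\<Sum>k=0..n. card (partitions_in (D s) k \<times> partitions_in (D t) (n - k)))"
      using fin by (intro card_UN_disjoint) (auto simp: partitions_in_def)
    ultimately show "Abs_fps (\<lambda>n. int (B s t n)) $ n = (partitions_gf (D s) * partitions_gf (D t)) $ n"
      by (simp add: B_def fps_mult_nth partitions_gf_def card_cartesian_product)
  qed
  then have "Abs_fps (\<lambda>n. int (B s t n)) * euler 1 ^ 2
      = (partitions_gf (D s) * euler 1) * (partitions_gf (D t) * euler 1)"
    by (simp only: power2_eq_square mult_ac)
  then show ?thesis
    using assms by (simp only: D_def partitions_gf_regular)
qed

section \<open>Reduction to the form x^2 + 6 y^2\<close>

text \<open>Cancellation of a unit modulo \<open>c\<close>, by the same recursion on coefficients as
  in \<open>fps_eq_upto_mult_left_cancel\<close>.\<close>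

lemma dvd_fps_mult_unit:
  fixes U K :: "int fps"
  assumes "U $ 0 = 1" and "\<And>n. c dvd (U * K) $ n"
  shows "c dvd K $ n"
proof (induction n rule: less_induct)
  case (less n)
  have "(U * K) $ n = K $ n + (\<Sum>k=Suc 0..n. U $ k * K $ (n - k))"
    using assms(1) by (simp add: fps_mult_nth sum.atLeast_Suc_atMost)
  moreover have "c dvd (\<Sum>k=Suc 0..n. U $ k * K $ (n - k))"
    using less by (intro dvd_sum dvd_mult) auto
  ultimately show ?case using assms(2)[of n] by (metis dvd_add_left_iff)
qed

lemma five_dvd_iff: "(5 :: int fps) dvd F \<longleftrightarrow> (\<forall>n. 5 dvd F $ n)"
proof
  assume "5 dvd F"
  then show "\<forall>n. 5 dvd F $ n" by (auto simp: numeral_fps_const elim!: dvdE)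
next
  assume *: "\<forall>n. 5 dvd F $ n"
  have "F = 5 * Abs_fps (\<lambda>n. F $ n div 5)"
    using * by (simp add: fps_eq_iff numeral_fps_const)
  then show "5 dvd F" by (rule dvdI)
qed

text \<open>Frobenius modulo 5, applied factor by factor: \<open>(1 - x)^5\<close> and
  \<open>1 - x^5\<close> differ by a multiple of 5.\<close>

lemma freshman_euler_prod: "(5 :: int fps) dvd euler_prod 1 n ^ 5 - euler_prod 5 n"
proof (induction n)
  case (Suc n)
  define x where "x = (fps_X :: int fps) ^ Suc n"
  have x5: "(fps_X :: int fps) ^ (5 * Suc n) = x ^ 5"
    by (simp only: x_def power_mult[symmetric] mult.commute)
  have "(1 - x) ^ 5 - (1 - x ^ 5) = 5 * (- x + 2 * x ^ 2 - 2 * x ^ 3 + x ^ 4)"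
    by algebra
  then have "5 dvd (1 - x) ^ 5 - (1 - x ^ 5)" by (rule dvdI)
  moreover have "euler_prod 1 (Suc n) = euler_prod 1 n * (1 - x)"
    by (simp add: euler_prod_Suc x_def)
  then have "euler_prod 1 (Suc n) ^ 5 - euler_prod 5 (Suc n)
     = (euler_prod 1 n ^ 5 - euler_prod 5 n) * (1 - x) ^ 5 + euler_prod 5 n * ((1 - x) ^ 5 - (1 - x ^ 5))"
    by (simp only: euler_prod_Suc[of 5] x5 power_mult_distrib) (simp add: algebra_simps)
  ultimately show ?case using Suc.IH by (simp add: dvd_add dvd_mult dvd_mult2)
qed simp

lemma freshman_euler: "(5 :: int fps) dvd euler 1 ^ 5 - euler 5"
  unfolding five_dvd_iff
proof
  fix n
  have "fps_eq_upto n (euler 1 ^ 5 - euler 5) (euler_prod 1 n ^ 5 - euler_prod 5 n)"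
    by (intro fps_eq_upto_diff fps_eq_upto_power euler_upto) auto
  then show "5 dvd (euler 1 ^ 5 - euler 5) $ n"
    using freshman_euler_prod[of n] unfolding five_dvd_iff by (metis fps_eq_uptoD order_refl)
qed

section \<open>Theta products as sums over a quadratic form\<close>

lemma theta_compose:
  assumes "d > 0"
  shows "theta w e oo fps_X ^ d = theta w (\<lambda>j. d * e j)"
proof (rule fps_ext)
  fix n
  have "e j = n div d \<longleftrightarrow> d * e j = n" if "d dvd n" for j
    using that assms by auto
  moreover have "d * e j \<noteq> n" if "\<not> d dvd n" for j
    using that by auto
  ultimately show "(theta w e oo fps_X ^ d) $ n = theta w (\<lambda>j. d * e j) $ n"
    using assms by (auto simp: fps_compose_X_power_nth theta_def intro!: sum.cong)
qed

lemma theta_mult_nth: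
  assumes "\<And>n. finite {i. e i = n}" "\<And>n. finite {j. f j = n}"
  shows "(theta w e * theta v f) $ n = (\<Sum>(i, j) | e i + f j = n. w i * v j)"
proof -
  define S where "S = {(i, j). e i + f j = n}"
  have fiber: "{p \<in> S. e (fst p) = k} = {i. e i = k} \<times> {j. f j = n - k}" if "k \<le> n" for k
    using that by (auto simp: S_def)
  have "S = (\<Union>k\<in>{0..n}. {i. e i = k} \<times> {j. f j = n - k})"
    by (auto simp: S_def)
  then have fin: "finite S" using assms by auto
  have "(theta w e * theta v f) $ n
      = (\<Sum>k=0..n. (\<Sum>i | e i = k. w i) * (\<Sum>j | f j = n - k. v j))"
    by (simp add: fps_mult_nth theta_def)
  also have "\<dots> = (\<Sum>k=0..n. \<Sum>(i, j)\<in>{p \<in> S. e (fst p) = k}. w i * v j)"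
    by (intro sum.cong refl) (simp add: fiber sum_product sum.cartesian_product)
  also have "\<dots> = (\<Sum>(i, j)\<in>S. w i * v j)"
    using fin by (intro sum.group) (auto simp: S_def)
  finally show ?thesis by (simp add: S_def)
qed

text \<open>Up to sign this is the sum of \<open>(-1)\<^bsup>(y - 1) / 2\<^esup> y\<close> over all odd integers \<open>x, y\<close> with
  \<open>x\<^sup>2 + 6 y\<^sup>2 = 8 n + 7\<close>, where \<open>y = 2 i - 1\<close> and \<open>x = 2 j - 1\<close>.\<close>

definition form_sum :: "nat \<Rightarrow> int" where
  "form_sum n = (\<Sum>(i, j) | (2 * j - 1)\<^sup>2 + 6 * (2 * i - 1)\<^sup>2 = 8 * int n + 7. alt_sign i * (2 * i - 1))"

lemma eight_theta_exp: "8 * int (theta_exp 0 1 j) + 1 = (2 * j - 1)\<^sup>2"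
  using two_theta_exp[of 0 1 j] by (simp add: power2_eq_square algebra_simps)

lemma theta_cube_psi_nth: "((theta_cube oo fps_X ^ 6) * theta_psi) $ n = form_sum n"
proof -
  let ?e = "theta_exp 0 1"
  have fin: "finite {j. ?e j = n}" for n
  proof (rule finite_subset)
    have "\<bar>j\<bar> \<le> int n + 1" if "?e j = n" for j
      using theta_exp_ge[of 0 1 j] that by simp
    then show "{j. ?e j = n} \<subseteq> {- int n - 1..int n + 1}" by fastforce
  qed simp
  have fin6: "finite {j. 6 * ?e j = n}" for n
    by (rule finite_subset[OF _ fin[of "n div 6"]]) auto
  \<comment> \<open>Completing squares: multiply by 8 and add \<open>6 + 1 = 7\<close>.\<close>
  have iff: "6 * ?e i + ?e j = n \<longleftrightarrow> (2 * j - 1)\<^sup>2 + 6 * (2 * i - 1)\<^sup>2 = 8 * int n + 7" for i j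
    unfolding eight_theta_exp[symmetric] by arith
  show ?thesis
    unfolding theta_cube_def theta_psi_def form_sum_def theta_compose[of 6, simplified]
    by (simp only: theta_mult_nth[OF fin6 fin] iff mult_1_right)
qed

text \<open>The trisection gives \<open>G * euler 1 ^ 5 = - euler 5 * T\<close>. Modulo 5 the two
  Euler factors agree, and \<open>euler 5\<close> is a unit, so \<open>G\<close> is congruent to
  \<open>- T\<close>.\<close>

lemma B_cong_form_sum: "[int (B 2 15 (3 * n + 2)) = - form_sum n] (mod 5)"
proof -
  define F where "F = Abs_fps (\<lambda>n. int (B 2 15 n))"
  define G where "G = fps_section 3 2 F"
  define T where "T = (theta_cube oo fps_X ^ 6) * theta_psi"
  have "F * theta_phi * euler 2 = F * euler 1 ^ 2"
    using theta_phi_eq by (simp only: theta_phi_def mult.assoc)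
  also have "\<dots> = euler 15 * euler 2"
    using regular_bipartitions_gf[of 2 15] by (simp add: F_def mult.commute)
  finally have "F * theta_phi * euler 2 = euler 15 * euler 2" .
  then have "F * theta_phi = euler 15" by simp
  then have G: "G * euler 1 ^ 5 = - euler 5 * T"
    unfolding G_def T_def by (rule trisection_of_inverse_phi)
  obtain H where H: "euler 1 ^ 5 - euler 5 = 5 * H"
    using freshman_euler by (elim dvdE)
  have "euler 5 * (G + T) = 5 * (- G * H)"
    using G H by algebra
  then have "(5 :: int fps) dvd euler 5 * (G + T)" by (rule dvdI)
  then have "5 dvd (euler 5 * (G + T)) $ k" for k by (simp only: five_dvd_iff)
  then have "5 dvd (G + T) $ n" by (rule dvd_fps_mult_unit[rotated]) simp
  moreover have "(G + T) $ n = int (B 2 15 (3 * n + 2)) - (- form_sum n)"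
    by (simp add: G_def F_def T_def fps_section_def theta_cube_psi_nth)
  ultimately show ?thesis by (simp only: cong_iff_dvd_diff)
qed

section \<open>Vanishing and self-similarity of the form sums\<close>

text \<open>The represented number is \<open>24 n + 23\<close>, which is 2 modulo 3, whereas the
  form reduces to a square modulo 3.\<close>

lemma form_sum_3n_plus_2: "form_sum (3 * n + 2) = 0"
proof -
  have "(2 * j - 1)\<^sup>2 + 6 * (2 * i - 1)\<^sup>2 \<noteq> 8 * int (3 * n + 2) + 7" for i j :: int
    using square_mod_3[of "2 * j - 1"] by (auto split: if_splits) presburger+
  then show ?thesis by (simp add: form_sum_def)
qed

text \<open>Modulo 3 the equation forces 3 to divide \<open>x\<close>; then \<open>x^2\<close> is
  divisible by 9, and dividing by 3 leaves a condition on \<open>y\<close> modulo 3.\<close>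

lemma form_dvd_3:
  fixes x y :: int
  assumes "x\<^sup>2 + 6 * y\<^sup>2 = 9 * k + 3 * r"
  shows "3 dvd x" "2 * y\<^sup>2 mod 3 = r mod 3"
proof -
  show "3 dvd x"
    using square_mod_3[of x] assms by (auto split: if_splits) presburger
  then obtain z where "x = 3 * z" by auto
  then have "2 * y\<^sup>2 = r + 3 * (k - z\<^sup>2)" using assms by (simp add: power_mult_distrib)
  then show "2 * y\<^sup>2 mod 3 = r mod 3" by (simp only: mod_mult_self2)
qed

text \<open>The represented number is \<open>9 (8 n + 4) + 3\<close>, so \<open>2 y^2\<close> would
  be 1 and \<open>y^2\<close> would be 2 modulo 3.\<close>

lemma form_sum_9n_plus_4: "form_sum (9 * n + 4) = 0"
proof -
  have "(2 * j - 1)\<^sup>2 + 6 * (2 * i - 1)\<^sup>2 \<noteq> 8 * int (9 * n + 4) + 7" for i j :: int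
  proof
    assume "(2 * j - 1)\<^sup>2 + 6 * (2 * i - 1)\<^sup>2 = 8 * int (9 * n + 4) + 7"
    then have "(2 * j - 1)\<^sup>2 + 6 * (2 * i - 1)\<^sup>2 = 9 * (8 * int n + 4) + 3 * 1" by simp
    from form_dvd_3(2)[OF this] square_mod_3[of "2 * i - 1"] show False
      by (auto split: if_splits) presburger+
  qed
  then show ?thesis by (simp add: form_sum_def)
qed

text \<open>The represented number is \<open>9 (8 n + 7)\<close>, which forces 3 to divide both
  \<open>x\<close> and \<open>y\<close>. Dividing by 3 is the map \<open>i = 3 i' - 1\<close>,
  \<open>j = 3 j' - 1\<close>; the weight gains 3 from \<open>y\<close> and -1 from the change of
  parity of \<open>i\<close>.\<close>

lemma form_sum_9n_plus_7: "form_sum (9 * n + 7) = - 3 * form_sum n"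
proof -
  define S where "S n = {(i, j). (2 * j - 1)\<^sup>2 + 6 * (2 * i - 1)\<^sup>2 = 8 * int n + 7}" for n
  let ?f = "\<lambda>(i, j). (3 * i - 1, 3 * j - 1) :: int \<times> int"
  have scale: "2 * (3 * i - 1) - 1 = 3 * (2 * i - 1)" for i :: int by simp
  have inj: "inj_on ?f (S n)" by (auto simp: inj_on_def)
  have "S (9 * n + 7) = ?f ` S n"
  proof (intro equalityI subsetI)
    fix p assume "p \<in> S (9 * n + 7)"
    then obtain i j where p: "p = (i, j)" and
      eq: "(2 * j - 1)\<^sup>2 + 6 * (2 * i - 1)\<^sup>2 = 9 * (8 * int n + 7) + 3 * 0"
      by (auto simp: S_def)
    have "3 dvd 2 * i - 1"
      using form_dvd_3(2)[OF eq] square_mod_3[of "2 * i - 1"] by (auto split: if_splits) presburger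
    then have "i = 3 * ((i + 1) div 3) - 1" by presburger
    then obtain i' where i': "i = 3 * i' - 1" ..
    from form_dvd_3(1)[OF eq] have "j = 3 * ((j + 1) div 3) - 1" by presburger
    then obtain j' where j': "j = 3 * j' - 1" ..
    have "(i', j') \<in> S n"
      using eq unfolding i' j' scale power_mult_distrib by (simp add: S_def)
    then show "p \<in> ?f ` S n" by (force simp: p i' j')
  next
    fix p assume "p \<in> ?f ` S n"
    then obtain i j where p: "p = (3 * i - 1, 3 * j - 1)" and "(i, j) \<in> S n" by auto
    then show "p \<in> S (9 * n + 7)"
      unfolding S_def p by (simp only: mem_Collect_eq prod.case scale power_mult_distrib) simp
  qed
  then have "form_sum (9 * n + 7) = (\<Sum>(i, j)\<in>?f ` S n. alt_sign i * (2 * i - 1))"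
    unfolding form_sum_def S_def[symmetric] by (simp only:)
  also have "\<dots> = (\<Sum>(i, j)\<in>S n. alt_sign (3 * i - 1) * (2 * (3 * i - 1) - 1))"
    unfolding sum.reindex[OF inj] by (intro sum.cong) auto
  also have "\<dots> = (\<Sum>(i, j)\<in>S n. - 3 * (alt_sign i * (2 * i - 1)))"
    unfolding scale by (intro sum.cong) auto
  also have "\<dots> = - 3 * form_sum n"
    by (simp add: form_sum_def S_def sum_distrib_left case_prod_unfold)
  finally show ?thesis .
qed

text \<open>Indices are tracked through \<open>8 N + 7\<close>, because the step from
  \<open>N\<close> to \<open>9 N + 7\<close> multiplies this quantity by 9.\<close>

lemma form_sum_iterate:
  assumes "8 * N + 7 = 9 ^ m * (8 * n + 7)"
  shows "form_sum N = (- 3) ^ m * form_sum n"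
  using assms
proof (induction m arbitrary: N)
  case (Suc m)
  \<comment> \<open>Powers of 9 are 1 modulo 8, so the intermediate value again has the shape
    \<open>8 K + 7\<close>.\<close>
  have "(9 :: nat) ^ m mod 8 = 1" by (simp add: power_mod[symmetric])
  then have "9 ^ m * (8 * n + 7) mod 8 = 7" by (simp add: mod_mult_eq[symmetric])
  then obtain K where K: "9 ^ m * (8 * n + 7) = 8 * K + 7"
    by (metis mult_div_mod_eq)
  then have "8 * N + 7 = 9 * (8 * K + 7)" using Suc.prems by simp
  then have "N = 9 * K + 7" by simp
  then show ?case using Suc.IH[OF K[symmetric]] by (simp add: form_sum_9n_plus_7)
qed simp

text \<open>With \<open>L = 3 N + 2\<close> one has \<open>8 L + 5 = 3 (8 N + 7)\<close>. Each of
  the three families of arguments fits this pattern.\<close>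

lemma B_iterate:
  assumes "8 * L + 5 = 3 * 9 ^ m * (8 * n + 7)"
  shows "[int (B 2 15 L) = (- 3) ^ m * - form_sum n] (mod 5)"
proof -
  have "(8 * L + 5) mod 3 = 0" by (simp only: assms mult.assoc mod_mult_self1_is_0)
  then have "L mod 3 = 2" by presburger
  then obtain N where L: "L = 3 * N + 2" by (metis mult_div_mod_eq)
  then have "8 * N + 7 = 9 ^ m * (8 * n + 7)" using assms by simp
  then show ?thesis using B_cong_form_sum[of N] form_sum_iterate[of N m n] by (simp add: L)
qed

lemma cong_int_zero: "[int a = 0] (mod 5) \<Longrightarrow> [a = 0] (mod 5)"
  by (metis cong_int_iff of_nat_0 of_nat_numeral)

theorem theorem1p1:
  fixes n m :: nat
  shows "[B 2 15 (3 ^ (2 * m + 1) * n + (7 * 3 ^ (2 * m + 1) - 5) div 8)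
            = 2 ^ m * B 2 15 (3 * n + 2)] (mod 5)
       \<and> [B 2 15 (3 ^ (2 * m + 2) * n + (23 * 3 ^ (2 * m + 1) - 5) div 8) = 0] (mod 5)
       \<and> [B 2 15 (3 ^ (2 * (m + 1) + 1) * n + (13 * 3 ^ (2 * (m + 1)) - 5) div 8) = 0] (mod 5)"
proof -
  have "(9 :: nat) ^ m mod 8 = 1" by (simp add: power_mod[symmetric])
  \<comment> \<open>Writing \<open>9^m = 8 c + 1\<close> exhibits the divisions by 8 as exact and
    keeps the natural-number subtractions from truncating.\<close>
  then obtain c where c: "(9 :: nat) ^ m = 8 * c + 1" by (metis mult_div_mod_eq)
  then have p: "(3 :: nat) ^ (2 * m + 1) = 24 * c + 3" "(3 :: nat) ^ (2 * m + 2) = 72 * c + 9"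
    "(3 :: nat) ^ (2 * (m + 1)) = 72 * c + 9" "(3 :: nat) ^ (2 * (m + 1) + 1) = 216 * c + 27"
    by (simp_all add: power_add power_mult)
  have q: "7 * (24 * c + 3) - 5 = 8 * (21 * c + 2)" "23 * (24 * c + 3) - 5 = 8 * (69 * c + 8)"
    "13 * (72 * c + 9) - 5 = 8 * (117 * c + 14)"
    by simp_all
  have d: "8 * k div 8 = k" for k :: nat by simp
  have "8 * (3 ^ (2 * m + 1) * n + (7 * 3 ^ (2 * m + 1) - 5) div 8) + 5 = 3 * 9 ^ m * (8 * n + 7)"
    unfolding p q d c by (simp add: algebra_simps)
  from B_iterate[OF this]
  have "[int (B 2 15 (3 ^ (2 * m + 1) * n + (7 * 3 ^ (2 * m + 1) - 5) div 8))
      = (- 3) ^ m * - form_sum n] (mod 5)" .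
  \<comment> \<open>Here \<open>-3\<close> is 2 modulo 5, and \<open>- form_sum n\<close> is turned
    back into \<open>B 2 15 (3 * n + 2)\<close>.\<close>
  also have "[(- 3) ^ m * - form_sum n = 2 ^ m * int (B 2 15 (3 * n + 2))] (mod 5)"
    by (intro cong_mult cong_pow cong_sym[OF B_cong_form_sum]) (simp add: cong_def)
  finally have "[int (B 2 15 (3 ^ (2 * m + 1) * n + (7 * 3 ^ (2 * m + 1) - 5) div 8))
      = int (2 ^ m * B 2 15 (3 * n + 2))] (mod int 5)" by simp
  \<comment> \<open>The factor \<open>24 n + 23\<close> that remains belongs to the index
    \<open>3 n + 2\<close>, where the form sum vanishes.\<close>
  moreover have "8 * (3 ^ (2 * m + 2) * n + (23 * 3 ^ (2 * m + 1) - 5) div 8) + 5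
      = 3 * 9 ^ m * (8 * (3 * n + 2) + 7)"
    unfolding p q d c by (simp add: algebra_simps)
  from B_iterate[OF this]
  have "[B 2 15 (3 ^ (2 * m + 2) * n + (23 * 3 ^ (2 * m + 1) - 5) div 8) = 0] (mod 5)"
    unfolding form_sum_3n_plus_2 by (intro cong_int_zero) simp
  \<comment> \<open>Likewise \<open>72 n + 39\<close> belongs to the index
    \<open>9 n + 4\<close>.\<close>
  moreover have "8 * (3 ^ (2 * (m + 1) + 1) * n + (13 * 3 ^ (2 * (m + 1)) - 5) div 8) + 5
      = 3 * 9 ^ m * (8 * (9 * n + 4) + 7)"
    unfolding p q d c by (simp add: algebra_simps)
  from B_iterate[OF this]
  have "[B 2 15 (3 ^ (2 * (m + 1) + 1) * n + (13 * 3 ^ (2 * (m + 1)) - 5) div 8) = 0] (mod 5)"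
    unfolding form_sum_9n_plus_4 by (intro cong_int_zero) simp
  ultimately show ?thesis unfolding cong_int_iff by blast
qed

end
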